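(* Let $\rho>0$, $x\in[0,1/2]$, and $N\ge4$. If $x=a/b$ is rational in lowest terms, then $K_N(2\pi x)=1$ exactly when $b\le N$. If $x$ is irrational, then $K_N(2\pi x)<1$ for every $N\ge4$. For badly approximable $x$, $$1-K_N(2\pi x)\asymp_xN^{-3},\qquad \frac{\Gamma_N(T_{\rho,2\pi x})}{\rho}-1\asymp_xN^{-3}\qquad(N\to\infty).$$ For every $N\ge4$, $$\max_{0\le\theta\le\pi}\left(\frac{\Gamma_N(T_{\rho,\theta})}{\rho}-1\right)=\frac1{\cos(\pi/N)}-1\sim\frac{\pi^2}{2N^2}\qquad(N\to\infty).$$ For $\varepsilon>0$, define $$B_x(\varepsilon)=\min\left\{N\ge4:\frac{\Gamma_N(T_{\rho,2\pi x})}{\rho}-1\le\varepsilon\right\}.$$ For badly approximable $x$, $B_x(\varepsilon)\asymp_x\varepsilon^{-1/3}$ as $\varepsilon\downarrow0$. If the polygon may depend on the angle but the same vertex bound must give this accuracy for every angle, i.e. if $B_{\mathrm{unif}}(\varepsilon)$ is the smallest integer $N\ge4$ with $\Gamma_N(T_{\rho,\theta})/\rho-1\le\varepsilon$ for all $\theta\in[0,\pi]$, then $$B_{\mathrm{unif}}(\varepsilon)=\max\left\{4,\left\lceil\frac{\pi}{\arccos((1+\varepsilon)^{-1})}\right\rceil\right\}\sim\frac{\pi}{\sqrt{2\varepsilon}}\qquad(\varepsilon\downarrow0).$$ Both vertex bounds $B_x(\varepsilon)$ and $B_{\mathrm{unif}}(\varepsilon)$ are independent of $\rho$.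
   Context: $\Theta_N\subset\mathbb C$ is the set of all eigenvalues of real row-stochastic $N\times N$ matrices, and $K_N(\theta)=\max\{r\ge0:re^{i\theta}\in\Theta_N\}$ for $0\le\theta\le\pi$. $R_\theta$ is rotation of $\mathbb R^2$ through $\theta$, $T_{\rho,\theta}=\rho R_\theta$, and $$\Gamma_N(T_{\rho,\theta})=\inf\{\gamma>0:T_{\rho,\theta}P\subseteq\gamma P\text{ for some convex polygon }P\text{ with at most }N\text{ vertices and }0\in\operatorname{int}P\}.$$ A real $x$ is badly approximable if some $c_x>0$ satisfies $|x-a/b|\ge c_x/b^2$ for every rational $a/b$ with $b\ge1$. For positive quantities, $a_N\asymp_xb_N$ means that $a_N/b_N$ is bounded above and below (in the stated limit) by positive constants depending only on $x$. *)

theory Defs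
  imports "HOL-Analysis.Analysis" "HOL-Library.Landau_Symbols" "Jordan_Normal_Form.Char_Poly"
begin

text \<open>
  Vectors of the plane live in \<^typ>\<open>real^2\<close>, whereas square matrices of varying size are
  those of the entry Jordan Normal Form. The notation of the latter for vectors is
  switched off where it collides with the one of Finite Cartesian Products.
\<close>

no_notation vec_index (infixl "$" 100)
hide_const (open) Matrix.vec

definition row_stochastic :: "nat \<Rightarrow> real mat \<Rightarrow> bool" where
  "row_stochastic N A \<longleftrightarrow> A \<in> carrier_mat N N \<and>
     (\<forall>i<N. \<forall>j<N. 0 \<le> A $$ (i, j)) \<and> (\<forall>i<N. (\<Sum>j<N. A $$ (i, j)) = 1)"

definition Theta_stoch :: "nat \<Rightarrow> complex set" where
  "Theta_stoch N = {z. \<exists>A. row_stochastic N A \<and> eigenvalue (map_mat complex_of_real A) z}"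

definition K_radius :: "nat \<Rightarrow> real \<Rightarrow> real" where
  "K_radius N \<theta> = (GREATEST r. 0 \<le> r \<and> complex_of_real r * cis \<theta> \<in> Theta_stoch N)"

definition rotation :: "real \<Rightarrow> real^2 \<Rightarrow> real^2" where
  "rotation \<theta> x = (vector [vector [cos \<theta>, - sin \<theta>], vector [sin \<theta>, cos \<theta>]] :: real^2^2) *v x"

definition scaled_rotation :: "real \<Rightarrow> real \<Rightarrow> real^2 \<Rightarrow> real^2" where
  "scaled_rotation \<rho> \<theta> x = \<rho> *\<^sub>R rotation \<theta> x"

text \<open>
  A polytope in the plane with nonempty interior is a convex polygon, and its vertices
  are its extreme points.
\<close>

definition Gamma_polygon :: "nat \<Rightarrow> (real^2 \<Rightarrow> real^2) \<Rightarrow> real" where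
  "Gamma_polygon N T = Inf {\<gamma>. 0 < \<gamma> \<and>
     (\<exists>P. polytope P \<and> card {v. v extreme_point_of P} \<le> N \<and> 0 \<in> interior P \<and>
          T ` P \<subseteq> (\<lambda>p. \<gamma> *\<^sub>R p) ` P)}"

definition badly_approximable :: "real \<Rightarrow> bool" where
  "badly_approximable x \<longleftrightarrow>
     (\<exists>c>0. \<forall>a b :: int. 1 \<le> b \<longrightarrow> c / (of_int b)\<^sup>2 \<le> \<bar>x - of_int a / of_int b\<bar>)"

text \<open>
  Two-sided comparison with explicit constants, so that a statement can say on which
  parameters the constants may depend.
\<close>

definition comparable :: "real \<Rightarrow> real \<Rightarrow> 'a filter \<Rightarrow> ('a \<Rightarrow> real) \<Rightarrow> ('a \<Rightarrow> real) \<Rightarrow> bool" where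
  "comparable c C F f g \<longleftrightarrow> 0 < c \<and> 0 < C \<and> (\<forall>\<^sub>F t in F. c \<le> f t / g t \<and> f t / g t \<le> C)"

definition B_angle :: "real \<Rightarrow> real \<Rightarrow> real \<Rightarrow> nat" where
  "B_angle \<rho> x \<epsilon> = (LEAST N. 4 \<le> N \<and> Gamma_polygon N (scaled_rotation \<rho> (2 * pi * x)) / \<rho> - 1 \<le> \<epsilon>)"

definition B_unif :: "real \<Rightarrow> real \<Rightarrow> nat" where
  "B_unif \<rho> \<epsilon> =
     (LEAST N. 4 \<le> N \<and> (\<forall>\<theta>\<in>{0..pi}. Gamma_polygon N (scaled_rotation \<rho> \<theta>) / \<rho> - 1 \<le> \<epsilon>))"

end

theory Submission
  imports Defs "HOL-Real_Asymp.Real_Asymp"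
begin

text \<open>
  Expanding a stochastic eigenvector, \<open>z \<in> Theta_stoch N\<close> says that multiplication by \<open>z\<close> maps the
  convex hull of some at most \<open>N\<close> points, not all zero, into itself. As such an invariant polygon has
  \<open>0\<close> in its interior unless the angle is \<open>0\<close> or \<open>pi\<close>, the expansion factor \<open>Gamma_polygon\<close> is \<open>\<rho>\<close> divided
  by \<open>K_radius\<close>, and only the latter has to be estimated. Regular \<open>q\<close>-gons with \<open>q \<le> N\<close> give lower
  bounds. The only upper bound needed is that \<open>Theta_stoch N\<close> does not cross the chord from \<open>1\<close> to
  \<open>cis (2 * pi / N)\<close>. It is sharp at the angle \<open>pi / N\<close>, which settles the uniform statements; applied to
  a power of the multiplier whose exponent comes from Dirichlet's theorem, it yields the
  exponent 3 for badly approximable angles.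
\<close>

section \<open>Invariant polygons\<close>

text \<open>The exponent 3 splits as 2 + 1. For the lower estimate of \<open>1 - K\<close>, a power
  of exponent \<open>n \<le> 2 * N\<close> has an angle t of order 1/N in the first arc, where the
  chord lies about t/N, hence 1/N^2, inside the unit circle; Bernoulli's inequality costs one more
  factor N in returning from \<open>K ^ n\<close> to K. For the upper estimate, a regular q-gon with
  q of order N misses the angle by at most order 1/N^2, and near a vertex the loss along an edge is
  about that angle divided by N. Bad approximability keeps t away from 0 in the former and q of
  order N in the latter.

  Two obstacles shape the setup. The entries of an eigenvector may span a degenerate hull, so the
  definition below asks only that V contain a nonzero point. And \<open>K_radius\<close> is a
  \<open>GREATEST\<close>, about which nothing can be said before the maximum is known to exist;
  hence the compactness argument.\<close>

definition polygon_multiplier :: "nat \<Rightarrow> complex \<Rightarrow> bool" where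
  "polygon_multiplier N z \<longleftrightarrow>
     (\<exists>V. finite V \<and> card V \<le> N \<and> \<not> V \<subseteq> {0} \<and> (\<forall>v\<in>V. z * v \<in> convex hull V))"

lemma mult_convex_hull_subset:
  fixes z :: complex
  assumes "\<forall>v\<in>V. z * v \<in> convex hull V" and "w \<in> convex hull V"
  shows "z * w \<in> convex hull V"
proof -
  have "z * w \<in> convex hull ((*) z ` V)"
    by (rule in_convex_hull_linear_image)
       (use assms in \<open>auto intro!: linearI simp: algebra_simps\<close>)
  also have "\<dots> \<subseteq> convex hull V"
    using assms(1) by (intro hull_minimal) auto
  finally show ?thesis .
qed

lemma power_mult_convex_hull:
  fixes z :: complex
  assumes "\<forall>v\<in>V. z * v \<in> convex hull V" and "w \<in> convex hull V"
  shows "z ^ k * w \<in> convex hull V"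
  by (induction k) (use assms mult_convex_hull_subset[OF assms(1)] in \<open>auto simp: mult.assoc\<close>)

text \<open>The same V serves for all powers, so the vertex bound N does not deteriorate. This is
  what allows the first arc to be applied to a power of the multiplier.\<close>

lemma polygon_multiplier_power:
  assumes "polygon_multiplier N z" shows "polygon_multiplier N (z ^ k)"
proof -
  obtain V where V: "finite V" "card V \<le> N" "\<not> V \<subseteq> {0}" "\<forall>v\<in>V. z * v \<in> convex hull V"
    using assms unfolding polygon_multiplier_def by blast
  have "\<forall>v\<in>V. z ^ k * v \<in> convex hull V"
    using power_mult_convex_hull[OF V(4)] by (blast intro: hull_inc)
  with V(1-3) show ?thesis
    unfolding polygon_multiplier_def by blast
qed

lemma polygon_multiplier_cnj:
  assumes "polygon_multiplier N z" shows "polygon_multiplier N (cnj z)"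
proof -
  obtain V where V: "finite V" "card V \<le> N" "\<not> V \<subseteq> {0}" "\<forall>v\<in>V. z * v \<in> convex hull V"
    using assms unfolding polygon_multiplier_def by blast
  have lin: "linear cnj"
    by (intro linearI) auto
  have "cnj z * cnj v \<in> convex hull (cnj ` V)" if "v \<in> V" for v
    using in_convex_hull_linear_image[OF lin, of "z * v" V] V(4) that by simp
  moreover have "card (cnj ` V) \<le> N"
    using V(1,2) card_image_le le_trans by blast
  ultimately show ?thesis
    unfolding polygon_multiplier_def using V(1,3)
    by (intro exI[of _ "cnj ` V"]) auto
qed

section \<open>Vertices of maximal norm and multipliers of modulus 1\<close>

lemma finite_complex_max_norm:
  fixes V :: "complex set"
  assumes "finite V" "\<not> V \<subseteq> {0}"
  shows "\<exists>v\<in>V. v \<noteq> 0 \<and> (\<forall>w\<in>V. norm w \<le> norm v)"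
proof -
  have "finite (norm ` V)" "norm ` V \<noteq> {}"
    using assms by auto
  then have "Max (norm ` V) \<in> norm ` V" and le: "\<And>w. w \<in> V \<Longrightarrow> norm w \<le> Max (norm ` V)"
    by simp_all
  then obtain v where v: "v \<in> V" "Max (norm ` V) = norm v"
    by blast
  obtain w where "w \<in> V" "w \<noteq> 0"
    using assms(2) by blast
  then have "v \<noteq> 0"
    using le[of w] v by auto
  then show ?thesis
    using v le by auto
qed

lemma polygon_multiplier_norm_le:
  assumes "polygon_multiplier N z" shows "norm z \<le> 1"
proof -
  obtain V where V: "finite V" "\<not> V \<subseteq> {0}" "\<forall>v\<in>V. z * v \<in> convex hull V"
    using assms unfolding polygon_multiplier_def by blast
  obtain v where v: "v \<in> V" "v \<noteq> 0" "\<forall>w\<in>V. norm w \<le> norm v"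
    using finite_complex_max_norm[OF V(1,2)] by blast
  have "convex hull V \<subseteq> cball 0 (norm v)"
    using v by (intro hull_minimal) auto
  then have "norm (z * v) \<le> norm v"
    using V(3) v(1) by auto
  then show ?thesis
    using v(2) by (simp add: norm_mult)
qed

text \<open>Strict convexity of the disc: a point w of V with \<open>w \<noteq> x\<close> and norm
  at most that of x lies strictly below the tangent line of the circle at x. If x were not in V,
  this open half-plane would contain the whole hull.\<close>

lemma max_norm_in_convex_hull:
  fixes x :: complex
  assumes "x \<in> convex hull V" and "\<And>w. w \<in> V \<Longrightarrow> norm w \<le> norm x"
  shows "x \<in> V"
proof (rule ccontr)
  assume x: "x \<notin> V"
  have "inner x w < inner x x" if "w \<in> V" for w
  proof -
    have "w - x \<noteq> 0"
      using x that by auto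
    then have "0 < inner (w - x) (w - x)"
      by simp
    also have "\<dots> = (norm w)\<^sup>2 + (norm x)\<^sup>2 - 2 * inner x w"
      by (simp add: inner_diff_left inner_diff_right power2_norm_eq_inner inner_commute)
    also have "\<dots> \<le> 2 * (norm x)\<^sup>2 - 2 * inner x w"
      using assms(2)[OF that] by (simp add: power_mono)
    finally show ?thesis
      by (simp add: power2_norm_eq_inner)
  qed
  then have "convex hull V \<subseteq> {w. inner x w < inner x x}"
    by (intro hull_minimal convex_halfspace_lt) auto
  then show False
    using assms(1) by auto
qed

lemma cis_mult_eq_imp_of_int:
  assumes "cis (2 * pi * x * real k) = cis (2 * pi * x * real l)"
  obtains m :: int where "(real k - real l) * x = of_int m"
proof -
  have "cis (2 * pi * x * real k - 2 * pi * x * real l) = 1"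
    using assms by (simp flip: cis_divide)
  then have "cos (2 * pi * x * real k - 2 * pi * x * real l) = 1"
    by (metis cis.simps(1) one_complex.simps(1))
  then obtain m :: int where "2 * pi * x * real k - 2 * pi * x * real l = of_int m * 2 * pi"
    using cos_one_2pi_int by auto
  then have "2 * pi * ((real k - real l) * x) = 2 * pi * of_int m"
    by (simp add: algebra_simps)
  then have "(real k - real l) * x = of_int m"
    by simp
  then show ?thesis
    by (rule that)
qed

text \<open>A rotation preserves norms, so the orbit of a vertex of maximal norm stays in the hull
  at maximal norm, hence within the finite set V.\<close>

lemma unimodular_multiplier_orbit:
  assumes "polygon_multiplier N (cis \<theta>)"
  obtains V v where "finite V" "card V \<le> N" "v \<noteq> 0" "\<And>k. cis (\<theta> * real k) * v \<in> V"
proof -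
  obtain V where V: "finite V" "card V \<le> N" "\<not> V \<subseteq> {0}" "\<forall>v\<in>V. cis \<theta> * v \<in> convex hull V"
    using assms unfolding polygon_multiplier_def by blast
  obtain v where v: "v \<in> V" "v \<noteq> 0" "\<forall>w\<in>V. norm w \<le> norm v"
    using finite_complex_max_norm[OF V(1,3)] by blast
  have "cis \<theta> ^ k * v \<in> V" for k
  proof (rule max_norm_in_convex_hull)
    show "cis \<theta> ^ k * v \<in> convex hull V"
      by (rule power_mult_convex_hull[OF V(4) hull_inc[OF v(1)]])
    show "norm w \<le> norm (cis \<theta> ^ k * v)" if "w \<in> V" for w
      using v(3) that by (simp add: norm_mult norm_power)
  qed
  moreover have "cis (\<theta> * real k) = cis \<theta> ^ k" for k
    by (simp add: Complex.DeMoivre mult.commute)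
  ultimately show ?thesis
    using that[OF V(1,2) v(2)] by simp
qed

text \<open>The orbit of a maximal vertex under a rotation of exact order b has b distinct points,
  all of them in V.\<close>

lemma unimodular_multiplier_rational:
  assumes "polygon_multiplier N (cis (2 * pi * x))" and "x = of_int a / of_int b"
    and "1 \<le> b" and "coprime a b"
  shows "b \<le> int N"
proof -
  obtain V v where V: "finite V" "card V \<le> N" "v \<noteq> 0"
    and orb: "\<And>k. cis (2 * pi * x * real k) * v \<in> V"
    using unimodular_multiplier_orbit[OF assms(1)] by metis
  have "inj_on (\<lambda>k. cis (2 * pi * x * real k) * v) {..<nat b}"
  proof (rule inj_onI)
    fix k l assume kl: "k \<in> {..<nat b}" "l \<in> {..<nat b}"
      and "cis (2 * pi * x * real k) * v = cis (2 * pi * x * real l) * v"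
    then have "cis (2 * pi * x * real k) = cis (2 * pi * x * real l)"
      using V(3) by simp
    then obtain m :: int where "(real k - real l) * x = of_int m"
      by (rule cis_mult_eq_imp_of_int)
    then have "real_of_int ((int k - int l) * a) = real_of_int (m * b)"
      using assms(2,3) by (simp add: field_simps)
    then have "(int k - int l) * a = m * b"
      by (simp only: of_int_eq_iff)
    then have "b dvd int k - int l"
      using assms(4) by (metis coprime_commute coprime_dvd_mult_left_iff dvd_triv_right)
    moreover have "\<bar>int k - int l\<bar> < b"
      using kl by auto
    ultimately show "k = l"
      using zdvd_imp_le[of b "\<bar>int k - int l\<bar>"] by auto
  qed
  then have "card {..<nat b} \<le> card V"
    using orb V(1) by (intro card_inj_on_le) auto
  then show ?thesis
    using V(2) by simp
qed

lemma unimodular_multiplier_imp_rational: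
  assumes "polygon_multiplier N (cis (2 * pi * x))"
  shows "x \<in> \<rat>"
proof (rule ccontr)
  assume x: "x \<notin> \<rat>"
  obtain V v where V: "finite V" "v \<noteq> 0"
    and orb: "\<And>k. cis (2 * pi * x * real k) * v \<in> V"
    using unimodular_multiplier_orbit[OF assms(1)] by metis
  have "inj (\<lambda>k. cis (2 * pi * x * real k) * v)"
  proof (rule injI, rule ccontr)
    fix k l assume "cis (2 * pi * x * real k) * v = cis (2 * pi * x * real l) * v" and kl: "k \<noteq> l"
    then have "cis (2 * pi * x * real k) = cis (2 * pi * x * real l)"
      using V(2) by simp
    then obtain m :: int where "(real k - real l) * x = of_int m"
      by (rule cis_mult_eq_imp_of_int)
    then have "x = of_int m / (real k - real l)"
      using kl by (simp add: field_simps)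
    then show False
      using x by simp
  qed
  then show False
    using orb V(1) by (meson finite_subset image_subsetI infinite_iff_countable_subset rev_finite_subset range_inj_infinite)
qed

section \<open>Invariant hulls with 0 in the interior\<close>

lemma interior_zero_small_multiple:
  fixes S :: "'a :: real_normed_vector set"
  assumes "0 \<in> interior S"
  obtains e where "e > 0" "e *\<^sub>R d \<in> S"
proof -
  obtain r where r: "r > 0" "ball 0 r \<subseteq> S"
    using assms mem_interior by blast
  have "0 < norm d + 1"
    by (simp add: add_nonneg_pos)
  moreover have "r * norm d < r * (norm d + 1)"
    using r(1) by simp
  ultimately have "r / (norm d + 1) * norm d < r"
    by (simp add: pos_divide_less_eq)
  then have "(r / (norm d + 1)) *\<^sub>R d \<in> ball 0 r"
    using r(1) by simp
  moreover have "0 < r / (norm d + 1)"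
    using r(1) \<open>0 < norm d + 1\<close> by simp
  ultimately show ?thesis
    using that r(2) by blast
qed

text \<open>A set with empty interior lies in a hyperplane, whose normal can be given the right
  sign. Otherwise 0 is separated from the interior, and the inequality passes to the
  closure.\<close>

lemma nonneg_functional_if_not_interior:
  fixes S :: "'a :: euclidean_space set"
  assumes "convex S" "closed S" "0 \<notin> interior S"
  obtains a where "a \<noteq> 0" "\<And>x. x \<in> S \<Longrightarrow> 0 \<le> inner a x"
proof (cases "interior S = {}")
  case True
  then obtain a b where ab: "a \<noteq> 0" "S \<subseteq> {x. inner a x = b}"
    using empty_interior_subset_hyperplane[OF assms(1)] by metis
  show ?thesis
  proof (cases "b \<ge> 0")
    case True
    then show ?thesis using ab that[of a] by auto
  next
    case False
    have "0 \<le> inner (- a) x" if "x \<in> S" for x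
      using ab(2) False that by auto
    then show ?thesis using ab(1) that[of "- a"] by auto
  qed
next
  case False
  obtain a where a: "a \<noteq> 0" "\<forall>x\<in>interior S. 0 \<le> inner a x"
    using separating_hyperplane_set_0[of "interior S"] assms by (auto simp: convex_interior)
  have "S \<subseteq> closure (interior S)"
    using assms False by (simp add: convex_closure_interior)
  also have "\<dots> \<subseteq> {x. 0 \<le> inner a x}"
    using a by (intro closure_minimal) (auto simp: closed_halfspace_ge)
  finally show ?thesis
    using a that by auto
qed

text \<open>Otherwise the hull would lie in a half-plane bounded by a line through 0. The orbit of a
  nonzero vertex turns by t at each step, and as \<open>t < pi\<close> it cannot jump over the
  opposite open half-plane.\<close>

lemma zero_in_interior_multiplier_hull:
  assumes V: "finite V" "\<not> V \<subseteq> {0}" "\<forall>v\<in>V. rcis r t * v \<in> convex hull V"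
    and rt: "0 < r" "0 < t" "t < pi"
  shows "0 \<in> interior (convex hull V)"
proof (rule ccontr)
  assume "0 \<notin> interior (convex hull V)"
  moreover have "closed (convex hull V)"
    using V(1) by (simp add: compact_imp_closed finite_imp_compact_convex_hull)
  ultimately obtain a where a: "a \<noteq> 0" "\<And>x. x \<in> convex hull V \<Longrightarrow> 0 \<le> inner a x"
    using nonneg_functional_if_not_interior[of "convex hull V"] by auto
  obtain v where v: "v \<in> V" "v \<noteq> 0"
    using V(2) by blast
  \<comment> \<open>Since \<open>inner a u = Re (cnj a * u)\<close>, the functional along the orbit
    becomes a positive multiple of the cosine of the current angle.\<close>
  define w where "w = cnj a * v"
  define \<phi> where "\<phi> = Arg w"
  have w: "w \<noteq> 0"
    using a v by (simp add: w_def)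
  have wp: "w = rcis (norm w) \<phi>"
    by (simp add: \<phi>_def rcis_cmod_Arg)
  have cos_nonneg: "0 \<le> cos (\<phi> + real k * t)" for k
  proof -
    have "0 \<le> inner a (rcis r t ^ k * v)"
      using power_mult_convex_hull[OF V(3) hull_inc[OF v(1)]] a(2) by simp
    also have "\<dots> = Re (rcis r t ^ k * w)"
      by (simp add: inner_complex_def w_def algebra_simps)
    also have "rcis r t ^ k * w = rcis (r ^ k * norm w) (real k * t + \<phi>)"
      by (subst wp) (simp add: DeMoivre2 rcis_mult)
    also have "Re \<dots> = r ^ k * norm w * cos (real k * t + \<phi>)"
      by simp
    finally show ?thesis
      using mult_le_cancel_left_pos[of "r ^ k * norm w" 0 "cos (\<phi> + real k * t)"] rt(1) w
      by (simp add: add.commute)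
  qed
  have "-pi < \<phi>" "\<phi> \<le> pi"
    using Arg_bounded[of w] by (auto simp: \<phi>_def)
  moreover have "0 \<le> cos \<phi>"
    using cos_nonneg[of 0] by simp
  ultimately have \<phi>: "\<phi> \<le> pi / 2"
    using cos_monotone_0_pi[of "pi / 2" \<phi>] by (cases "\<phi> \<le> pi / 2") auto
  obtain k0 :: nat where "real k0 * t > pi / 2 - \<phi>"
    using rt(2) reals_Archimedean3 by blast
  then have ex: "\<exists>k::nat. \<phi> + real k * t > pi / 2"
    by (auto simp: algebra_simps intro!: exI[of _ k0])
  \<comment> \<open>The first step beyond pi/2 starts from an angle of at most pi/2, so it ends
    below 3 * pi/2, where the cosine is negative.\<close>
  define k where "k = (LEAST k::nat. \<phi> + real k * t > pi / 2)"
  have k: "\<phi> + real k * t > pi / 2"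
    unfolding k_def by (rule LeastI_ex[OF ex])
  then have "k \<noteq> 0"
    using \<phi> by (cases "k = 0") auto
  then obtain k' where k': "k = Suc k'"
    using not0_implies_Suc by blast
  have "\<not> (\<phi> + real k' * t > pi / 2)"
    using not_less_Least[of k' "\<lambda>k. \<phi> + real k * t > pi / 2"] k' by (simp add: k_def)
  then have "\<phi> + real k * t < 3 * pi / 2"
    using rt(3) k' by (simp add: algebra_simps)
  then have "cos (\<phi> + real k * t - pi) > 0"
    using k by (intro cos_gt_zero_pi) linarith+
  then show False
    using cos_nonneg[of k] by (simp add: cos_diff)
qed

section \<open>The first arc\<close>

lemma inner_complex_diff_mult:
  "inner a (z * v - v) = inner a v * (Re z - 1) - Im (cnj a * v) * Im z"
  by (simp add: inner_complex_def algebra_simps)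

text \<open>Here w is the vertex after v in counterclockwise order. The edge from v to w supports
  the hull, so \<open>\<mu> * v\<close> lies on its left. Division by v yields the conclusion: \<mu>
  is not to the right of the line directed from 1 to \<open>w / v\<close>.\<close>

lemma convex_hull_next_vertex:
  fixes W :: "complex set"
  assumes W: "finite W" "0 \<in> interior (convex hull W)" "v \<in> W" "v \<notin> convex hull (W - {v})"
    and \<mu>: "\<mu> * v \<in> convex hull W"
  obtains w where "w \<in> W" "0 < Im (w / v)"
    "(1 - Re (w / v)) * Im \<mu> \<le> Im (w / v) * (1 - Re \<mu>)"
proof -
  obtain a b where ab: "inner a v < b" "\<forall>x\<in>convex hull (W - {v}). b < inner a x"
    using separating_hyperplane_closed_point[of "convex hull (W - {v})" v] W(1,4)
    by (auto simp: compact_imp_closed finite_imp_compact_convex_hull)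
  define X where "X w = inner a (w - v)" for w
  define Y where "Y w = Im (w / v)" for w
  have Xpos: "0 < X w" if "w \<in> W - {v}" for w
    using ab that hull_inc[of w "W - {v}"] by (fastforce simp: X_def inner_diff_right)
  have "W \<noteq> {v}"
    using W(2) by auto
  then have ne: "W - {v} \<noteq> {}"
    using W(3) by auto
  then obtain w' where "0 < X w'"
    using Xpos by blast
  then have a0: "a \<noteq> 0"
    by (auto simp: X_def)
  \<comment> \<open>The functional is minimal on the hull at v, and the hull contains a small
    negative multiple of a because 0 is interior.\<close>
  have A: "inner a v < 0"
  proof -
    obtain e where e: "e > 0" "e *\<^sub>R (- a) \<in> convex hull W"
      using interior_zero_small_multiple[OF W(2)] by metis
    have "inner a v \<le> inner a w" if "w \<in> W" for w
      using Xpos[of w] that by (cases "w = v") (auto simp: X_def inner_diff_right)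
    then have "convex hull W \<subseteq> {x. inner a v \<le> inner a x}"
      by (intro hull_minimal convex_halfspace_ge) auto
    then have "inner a v \<le> - (e * inner a a)"
      using e(2) by auto
    also have "\<dots> < 0"
      using e(1) a0 by simp
    finally show ?thesis .
  qed
  then have v0: "v \<noteq> 0"
    by auto
  have linY: "linear (\<lambda>w. Im (w / v))"
    by (intro bounded_linear.linear bounded_linear_compose[OF bounded_linear_Im bounded_linear_divide])
  \<comment> \<open>If all vertices satisfied \<open>Im (w / v) \<le> 0\<close>, the hull would miss
    every positive multiple of \<open>\<i> * v\<close>.\<close>
  obtain w0 where w0: "w0 \<in> W" "0 < Y w0"
  proof (rule ccontr)
    assume "\<not> thesis"
    then have "W \<subseteq> {w. Im (w / v) \<le> 0}"
      using that by (force simp: Y_def)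
    moreover have "convex {w. Im (w / v) \<le> 0}"
      using convex_linear_vimage[OF linY convex_real_interval(2)[of 0]] by (simp add: vimage_def)
    ultimately have *: "convex hull W \<subseteq> {w. Im (w / v) \<le> 0}"
      by (rule hull_minimal)
    obtain e where e: "e > 0" "e *\<^sub>R (\<i> * v) \<in> convex hull W"
      using interior_zero_small_multiple[OF W(2)] by metis
    then show False
      using * v0 by (auto simp: scaleR_conv_of_real)
  qed
  \<comment> \<open>Gift wrapping: the next vertex maximizes the slope \<open>Y / X\<close> in the half-plane \<open>X > 0\<close>.\<close>
  define m where "m = Max ((\<lambda>w. Y w / X w) ` (W - {v}))"
  have "m \<in> (\<lambda>w. Y w / X w) ` (W - {v})"
    unfolding m_def using W(1) ne by (intro Max_in) auto
  then obtain w where w: "w \<in> W - {v}" "m = Y w / X w"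
    by blast
  have le_m: "Y u / X u \<le> m" if "u \<in> W - {v}" for u
    unfolding m_def using W(1) that by (intro Max_ge) auto
  have "w0 \<noteq> v"
    using w0 v0 by (auto simp: Y_def)
  then have "0 < Y w0 / X w0"
    using w0 Xpos by auto
  also have "\<dots> \<le> m"
    using le_m w0 \<open>w0 \<noteq> v\<close> by simp
  finally have m: "0 < m" .
  \<comment> \<open>The edge line is \<open>Y = m * X\<close>. By the choice of m, all of W lies
    weakly below it, and hence so does \<open>\<mu> * v\<close>.\<close>
  have Yw: "Y w = m * X w"
    using w Xpos[of w] by auto
  have "Y u - m * X u \<le> 0" if "u \<in> W" for u
  proof (cases "u = v")
    case False
    then show ?thesis
      using le_m[of u] Xpos[of u] that by (simp add: divide_le_eq)
  qed (use v0 in \<open>simp add: X_def Y_def\<close>)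
  then have sub: "W \<subseteq> {u. Im (u / v) - m * inner a u \<le> - m * inner a v}"
    by (auto simp: X_def Y_def inner_diff_right algebra_simps)
  have lin: "linear (\<lambda>u. Im (u / v) - m * inner a u)"
    by (intro linear_compose_sub[OF linY] linearI) (auto simp: inner_add_right algebra_simps)
  have "convex {u. Im (u / v) - m * inner a u \<le> - m * inner a v}"
    using convex_linear_vimage[OF lin convex_real_interval(2)[of "- m * inner a v"]]
    by (simp add: vimage_def)
  with sub have "convex hull W \<subseteq> {u. Im (u / v) - m * inner a u \<le> - m * inner a v}"
    by (rule hull_minimal)
  then have "Im (\<mu> * v / v) - m * inner a (\<mu> * v) \<le> - m * inner a v"
    using \<mu> by auto
  then have "Im \<mu> \<le> m * inner a (\<mu> * v - v)"
    using v0 by (simp add: inner_diff_right algebra_simps)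
  then have l: "Im \<mu> * (1 + m * Im (cnj a * v)) \<le> (- m * inner a v) * (1 - Re \<mu>)"
    unfolding inner_complex_diff_mult by (simp add: algebra_simps)
  \<comment> \<open>The point z satisfies with equality the linear relation that \<mu> satisfies as
    an inequality. Eliminating the factor \<open>1 + m * Im (cnj a * v)\<close>, whose sign is
    unknown, removes the separating functional from the result.\<close>
  define z where "z = w / v"
  have "Im z = m * inner a (z * v - v)"
    using Yw v0 by (simp add: X_def Y_def z_def)
  then have z: "Im z * (1 + m * Im (cnj a * v)) = (- m * inner a v) * (1 - Re z)"
    unfolding inner_complex_diff_mult by (simp add: algebra_simps)
  have Imz: "0 < Im z"
    using Yw m Xpos[of w] w(1) by (simp add: Y_def z_def)
  define D where "D = - m * inner a v"
  have D: "0 < D"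
    using m A by (simp add: D_def mult_pos_neg)
  have "D * ((1 - Re z) * Im \<mu>) = D * (1 - Re z) * Im \<mu>"
    by simp
  also have "\<dots> = Im z * (1 + m * Im (cnj a * v)) * Im \<mu>"
    by (simp only: z D_def)
  also have "\<dots> = Im z * (Im \<mu> * (1 + m * Im (cnj a * v)))"
    by (simp only: mult_ac)
  also have "\<dots> \<le> Im z * (D * (1 - Re \<mu>))"
    using mult_left_mono[OF l less_imp_le[OF Imz]] by (simp only: D_def)
  also have "\<dots> = D * (Im z * (1 - Re \<mu>))"
    by (simp add: algebra_simps)
  finally have "(1 - Re z) * Im \<mu> \<le> Im z * (1 - Re \<mu>)"
    using D by simp
  then show ?thesis
    using that[of w] w(1) Imz by (simp add: z_def)
qed

text \<open>The search for the next vertex needs each vertex strictly separated from the others.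
  Extreme points have this property, because deleting an extreme point from the hull leaves a convex
  set.\<close>

lemma extreme_points_generate_hull:
  assumes "finite V"
  obtains W :: "'a :: euclidean_space set"
  where "W \<subseteq> V" "convex hull W = convex hull V" "\<And>v. v \<in> W \<Longrightarrow> v \<notin> convex hull (W - {v})"
proof
  let ?W = "{x. x extreme_point_of (convex hull V)}"
  show eq: "convex hull ?W = convex hull V"
    using assms Krein_Milman_Minkowski[of "convex hull V"]
    by (simp add: finite_imp_compact_convex_hull)
  show "?W \<subseteq> V"
    by (rule extreme_points_of_convex_hull)
  show "v \<notin> convex hull (?W - {v})" if "v \<in> ?W" for v
  proof
    assume *: "v \<in> convex hull (?W - {v})"
    have "convex (convex hull V - {v})"
      using that by (simp add: extreme_point_of_stillconvex)
    moreover have "?W - {v} \<subseteq> convex hull V - {v}"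
      by (auto simp: extreme_point_of_def)
    ultimately have "convex hull (?W - {v}) \<subseteq> convex hull V - {v}"
      by (intro hull_minimal)
    then show False
      using * by auto
  qed
qed

text \<open>The graph of the concave function \<open>ln \<circ> cos\<close> lies below its tangent
  at \<beta>; its derivative \<open>- tan\<close> is decreasing, so the mean value theorem on either
  side of \<beta> suffices.\<close>

lemma cos_tangent_bound:
  assumes \<beta>: "0 \<le> \<beta>" "\<beta> < pi / 2" and y: "- (pi / 2) < y" "y < pi / 2"
  shows "ln (cos y) \<le> ln (cos \<beta>) - tan \<beta> * (y - \<beta>)"
proof -
  have der: "((\<lambda>t. ln (cos t)) has_real_derivative - tan t) (at t)"
    if "- (pi / 2) < t" "t < pi / 2" for t
    using cos_gt_zero_pi[OF that] by (auto intro!: derivative_eq_intros simp: tan_def field_simps)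
  consider "y < \<beta>" | "y = \<beta>" | "\<beta> < y" by linarith
  then show ?thesis
  proof cases
    case 1
    obtain t where t: "y < t" "t < \<beta>" "ln (cos \<beta>) - ln (cos y) = (\<beta> - y) * - tan t"
      using MVT2[OF 1, of "\<lambda>t. ln (cos t)" "\<lambda>t. - tan t"] der \<beta> y by auto
    have "tan t \<le> tan \<beta>"
      using t \<beta> y tan_monotone[of t \<beta>] by simp
    then show ?thesis
      using t mult_left_mono[of "tan t" "tan \<beta>" "\<beta> - y"] 1 by (simp add: algebra_simps)
  next
    case 3
    obtain t where t: "\<beta> < t" "t < y" "ln (cos y) - ln (cos \<beta>) = (y - \<beta>) * - tan t"
      using MVT2[OF 3, of "\<lambda>t. ln (cos t)" "\<lambda>t. - tan t"] der \<beta> y by auto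
    have "tan \<beta> \<le> tan t"
      using t \<beta> y tan_monotone[of \<beta> t] by simp
    then show ?thesis
      using t mult_left_mono[of "tan \<beta>" "tan t" "y - \<beta>"] 3 by (simp add: algebra_simps)
  qed simp
qed

text \<open>Pigeonhole on the first \<open>card W + 1\<close> iterates. The map need not be
  injective, so the cycle may start at a later iterate u instead of v.\<close>

lemma finite_orbit_cycle:
  assumes "finite W" "v \<in> W" "\<And>w. w \<in> W \<Longrightarrow> s w \<in> W"
  obtains u n where "u \<in> W" "0 < n" "n \<le> card W" "(s ^^ n) u = u"
proof -
  have inW: "(s ^^ k) v \<in> W" for k
    by (induction k) (use assms in auto)
  have "\<not> inj_on (\<lambda>k. (s ^^ k) v) {..card W}"
    using card_inj_on_le[of "\<lambda>k. (s ^^ k) v" "{..card W}" W] inW assms(1) by auto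
  then obtain i j where ij: "i < j" "j \<le> card W" "(s ^^ i) v = (s ^^ j) v"
    unfolding inj_on_def by (metis atMost_iff linorder_neqE_nat)
  have "(s ^^ (j - i)) ((s ^^ i) v) = (s ^^ (j - i + i)) v"
    by (simp only: funpow_add o_apply)
  then show ?thesis
    using ij inW by (intro that[of "(s ^^ i) v" "j - i"]) auto
qed

lemma cis_eq_one_imp:
  assumes "cis t = 1" "0 < t" shows "2 * pi \<le> t"
proof -
  have "cos t = 1"
    using assms(1) by (metis cis.simps(1) one_complex.simps(1))
  then obtain m :: int where m: "t = of_int m * 2 * pi"
    using cos_one_2pi_int by auto
  then have "0 < real_of_int m * (2 * pi)"
    using assms(2) by simp
  then have "0 < m"
    by (simp add: zero_less_mult_iff)
  then have "1 * (2 * pi) \<le> real_of_int m * (2 * pi)"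
    by (intro mult_right_mono) auto
  then show ?thesis
    using m by simp
qed

text \<open>
  Each successor quotient lies beyond the line through \<open>1\<close> and \<open>cis (2 * pi / N)\<close>. In polar
  coordinates and after taking logarithms, concavity of \<open>ln \<circ> cos\<close> makes this incompatible with a
  closed cycle of at most \<open>N\<close> quotients, whose moduli multiply to 1 and whose arguments add up to
  a positive multiple of \<open>2 * pi\<close>.
\<close>

lemma multiplier_first_arc:
  assumes "polygon_multiplier N (rcis r t)" and N: "3 \<le> N" and rt: "0 < r" "0 < t" "t < pi"
  shows "r * cos (t - pi / real N) \<le> cos (pi / real N)"
proof (rule ccontr)
  define \<beta> where "\<beta> = pi / real N"
  define \<mu> where "\<mu> = rcis r t"
  assume "\<not> ?thesis"
  then have big: "cos \<beta> < r * cos (t - \<beta>)"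
    by (simp add: \<beta>_def)
  have \<beta>: "0 < \<beta>" "\<beta> < pi / 2"
    using N by (auto simp: \<beta>_def field_simps)
  then have cb: "0 < cos \<beta>" and sb: "0 < sin \<beta>"
    by (auto intro: cos_gt_zero sin_gt_zero)
  obtain V where V: "finite V" "card V \<le> N" "\<not> V \<subseteq> {0}" "\<forall>v\<in>V. \<mu> * v \<in> convex hull V"
    using assms(1) unfolding polygon_multiplier_def \<mu>_def by blast
  obtain W where W: "W \<subseteq> V" "convex hull W = convex hull V"
      "\<And>v. v \<in> W \<Longrightarrow> v \<notin> convex hull (W - {v})"
    using extreme_points_generate_hull[OF V(1)] by metis
  have finW: "finite W"
    using W(1) V(1) by (rule finite_subset)
  have cardW: "card W \<le> N"
    using card_mono[OF V(1) W(1)] V(2) by simp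
  have int0: "0 \<in> interior (convex hull W)"
    using zero_in_interior_multiplier_hull[of V r t] V rt by (simp add: W(2) \<mu>_def)
  have Im\<mu>: "0 < Im \<mu>"
    using rt by (simp add: \<mu>_def sin_gt_zero)
  have "\<exists>w\<in>W. 0 < Im (w / v) \<and> (1 - Re (w / v)) * Im \<mu> \<le> Im (w / v) * (1 - Re \<mu>)" if "v \<in> W" for v
  proof -
    have "\<mu> * v \<in> convex hull W"
      using V(4) W(1,2) that by auto
    then show ?thesis
      using convex_hull_next_vertex[OF finW int0 that W(3)[OF that]] by metis
  qed
  then obtain s where s: "\<And>v. v \<in> W \<Longrightarrow> s v \<in> W" "\<And>v. v \<in> W \<Longrightarrow> 0 < Im (s v / v)"
      "\<And>v. v \<in> W \<Longrightarrow> (1 - Re (s v / v)) * Im \<mu> \<le> Im (s v / v) * (1 - Re \<mu>)"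
    by metis
  have nz: "v \<noteq> 0" if "v \<in> W" for v
    using s(2)[OF that] by auto
  obtain v0 where "v0 \<in> W"
    using int0 by fastforce
  then obtain u n where u: "u \<in> W" "0 < n" "n \<le> card W" "(s ^^ n) u = u"
    using finite_orbit_cycle[of W v0 s] finW s(1) by blast
  have orbW: "(s ^^ k) u \<in> W" for k
    by (induction k) (use u s in auto)
  define z where "z k = s ((s ^^ k) u) / (s ^^ k) u" for k
  define \<alpha> where "\<alpha> k = Arg (z k)" for k
  \<comment> \<open>The line in question passes through 1 and \<open>cis (2 * \<beta>)\<close>. The
    assumption puts \<mu> strictly beyond it; seen from 1, \<open>z k\<close> is turned no further
    counterclockwise than \<mu>, so it lies beyond the line as well.\<close>
  have z_beyond: "cos \<beta> < Re (z k) * cos \<beta> + Im (z k) * sin \<beta>" for k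
  proof -
    have Imz: "0 < Im (z k)" and le: "(1 - Re (z k)) * Im \<mu> \<le> Im (z k) * (1 - Re \<mu>)"
      using s orbW by (simp_all add: z_def)
    have "cos \<beta> < Re \<mu> * cos \<beta> + Im \<mu> * sin \<beta>"
      using big by (simp add: \<mu>_def cos_diff algebra_simps)
    then have b: "(1 - Re \<mu>) * cos \<beta> < Im \<mu> * sin \<beta>"
      by (simp add: algebra_simps)
    have "Im \<mu> * ((1 - Re (z k)) * cos \<beta>) = (1 - Re (z k)) * Im \<mu> * cos \<beta>"
      by simp
    also have "\<dots> \<le> Im (z k) * (1 - Re \<mu>) * cos \<beta>"
      using le cb by (intro mult_right_mono) auto
    also have "\<dots> < Im (z k) * (Im \<mu> * sin \<beta>)"
      using b Imz by (simp add: mult.assoc)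
    finally have "Im \<mu> * ((1 - Re (z k)) * cos \<beta>) < Im \<mu> * (Im (z k) * sin \<beta>)"
      by (simp add: algebra_simps)
    then have "(1 - Re (z k)) * cos \<beta> < Im (z k) * sin \<beta>"
      using Im\<mu> by simp
    then show ?thesis
      by (simp add: algebra_simps)
  qed
  have z0: "z k \<noteq> 0" for k
    using orbW nz s(1) by (simp add: z_def)
  have \<alpha>: "0 < \<alpha> k" "\<alpha> k < pi" for k
    using s(2)[OF orbW[of k]] Arg_lt_pi[of "z k"] by (simp_all add: z_def \<alpha>_def)
  have polar: "z k = rcis (norm (z k)) (\<alpha> k)" for k
    by (simp add: \<alpha>_def rcis_cmod_Arg)
  have step: "tan \<beta> * (\<alpha> k - 2 * \<beta>) < ln (norm (z k))" for k
  proof -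
    have "Re (z k) * cos \<beta> + Im (z k) * sin \<beta> = norm (z k) * cos (\<alpha> k - \<beta>)"
      by (subst (1 2) polar) (simp add: cos_diff algebra_simps)
    then have zc: "cos \<beta> < norm (z k) * cos (\<alpha> k - \<beta>)"
      using z_beyond[of k] by simp
    then have "0 < norm (z k) * cos (\<alpha> k - \<beta>)"
      using cb by linarith
    then have c: "0 < cos (\<alpha> k - \<beta>)"
      using zero_less_mult_pos z0[of k] by (metis zero_less_norm_iff)
    \<comment> \<open>A positive cosine alone does not place the angle on the branch where the
      tangent bound holds; the range of \<alpha> does.\<close>
    have y: "\<alpha> k - \<beta> < pi / 2"
    proof (rule ccontr)
      assume "\<not> ?thesis"
      then have "cos (\<alpha> k - \<beta>) \<le> cos (pi / 2)"
        using \<alpha>[of k] \<beta> by (intro cos_monotone_0_pi_le) auto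
      then show False
        using c by simp
    qed
    have "ln (cos \<beta>) < ln (norm (z k) * cos (\<alpha> k - \<beta>))"
      using zc cb by (subst ln_less_cancel_iff) auto
    also have "\<dots> = ln (norm (z k)) + ln (cos (\<alpha> k - \<beta>))"
      using z0[of k] c by (simp add: ln_mult)
    also have "ln (cos (\<alpha> k - \<beta>)) \<le> ln (cos \<beta>) - tan \<beta> * (\<alpha> k - \<beta> - \<beta>)"
      using \<alpha>[of k] \<beta> y by (intro cos_tangent_bound) auto
    finally show ?thesis
      by simp
  qed
  \<comment> \<open>The quotients of successive vertices telescope, so their product around the
    cycle is 1.\<close>
  have "(\<Prod>k<j. z k) = (s ^^ j) u / u" for j
    by (induction j) (use nz u orbW in \<open>auto simp: z_def\<close>)
  then have prod: "(\<Prod>k<n. z k) = 1"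
    using u nz by simp
  have "(\<Sum>k<n. ln (norm (z k))) = ln (\<Prod>k<n. norm (z k))"
    using z0 by (intro ln_prod[symmetric]) auto
  also have "(\<Prod>k<n. norm (z k)) = norm (\<Prod>k<n. z k)"
    by (simp add: prod_norm)
  finally have "(\<Sum>k<n. ln (norm (z k))) = 0"
    using prod by simp
  moreover have "(\<Sum>k<n. tan \<beta> * (\<alpha> k - 2 * \<beta>)) < (\<Sum>k<n. ln (norm (z k)))"
    using step u(2) by (intro sum_strict_mono) auto
  ultimately have neg: "tan \<beta> * ((\<Sum>k<n. \<alpha> k) - 2 * \<beta> * real n) < 0"
    by (simp add: sum_distrib_left sum_subtractf algebra_simps)
  \<comment> \<open>The arguments are added without reduction modulo \<open>2 * pi\<close>. As each
    is positive, the sum around the cycle is at least one full turn, whereas \<open>neg\<close>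
    bounds it strictly by \<open>2 * \<beta> * n\<close>, which is at most \<open>2 * pi\<close>
    because \<open>n \<le> N\<close>.\<close>
  have "(\<Prod>k<j. z k) = rcis (\<Prod>k<j. norm (z k)) (\<Sum>k<j. \<alpha> k)" for j
  proof (induction j)
    case (Suc j)
    then show ?case
      by (simp add: polar[of j, symmetric] flip: rcis_mult)
  qed simp
  from this[of n] have "rcis 1 (\<Sum>k<n. \<alpha> k) = 1"
    using prod prod_norm[of z "{..<n}"] by simp
  then have "cis (\<Sum>k<n. \<alpha> k) = 1"
    by (simp add: rcis_def)
  moreover have "0 < (\<Sum>k<n. \<alpha> k)"
    using \<alpha> u(2) by (intro sum_pos) auto
  ultimately have "2 * pi \<le> (\<Sum>k<n. \<alpha> k)"
    by (rule cis_eq_one_imp)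
  moreover have "2 * \<beta> * real n \<le> 2 * pi"
  proof -
    have "real n \<le> real N"
      using u(3) cardW by simp
    then show ?thesis
      using N by (simp add: \<beta>_def divide_simps)
  qed
  moreover have "0 < tan \<beta>"
    using \<beta> by (simp add: tan_gt_zero)
  ultimately have "0 \<le> tan \<beta> * ((\<Sum>k<n. \<alpha> k) - 2 * \<beta> * real n)"
    by (intro mult_nonneg_nonneg) auto
  then show False
    using neg by simp
qed

section \<open>Stochastic eigenvalues\<close>

text \<open>The eigenvalue equation with plain functions in place of matrices, so that convex
  combinations and the product topology apply directly. The values of v are the points of the
  polygon and the rows of a are convex coefficients.\<close>

definition stochastic_multiplier :: "nat \<Rightarrow> complex \<Rightarrow> (nat \<Rightarrow> nat \<Rightarrow> real) \<Rightarrow> (nat \<Rightarrow> complex) \<Rightarrow> bool" where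
  "stochastic_multiplier N z a v \<longleftrightarrow>
     (\<forall>i<N. \<forall>j<N. 0 \<le> a i j) \<and> (\<forall>i<N. (\<Sum>j<N. a i j) = 1) \<and> (\<exists>i<N. v i \<noteq> 0) \<and>
     (\<forall>i<N. z * v i = (\<Sum>j<N. a i j *\<^sub>R v j))"

lemma mult_mat_vec_of_real_index:
  assumes "A \<in> carrier_mat N N" "x \<in> carrier_vec N" "i < N"
  shows "vec_index (map_mat complex_of_real A *\<^sub>v x) i = (\<Sum>j<N. A $$ (i, j) *\<^sub>R vec_index x j)"
  using assms by (simp add: scalar_prod_def scaleR_conv_of_real atLeast0LessThan)

lemma Theta_stoch_iff:
  "z \<in> Theta_stoch N \<longleftrightarrow> (\<exists>a v. stochastic_multiplier N z a v)"
proof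
  assume "z \<in> Theta_stoch N"
  then obtain A x where A: "row_stochastic N A" and x: "eigenvector (map_mat complex_of_real A) x z"
    by (auto simp: Theta_stoch_def eigenvalue_def)
  have carr: "A \<in> carrier_mat N N"
    using A by (simp add: row_stochastic_def)
  then have x': "x \<in> carrier_vec N" "x \<noteq> 0\<^sub>v N" "map_mat complex_of_real A *\<^sub>v x = z \<cdot>\<^sub>v x"
    using x by (auto simp: eigenvector_def)
  have "\<exists>i<N. vec_index x i \<noteq> 0"
  proof (rule ccontr)
    assume "\<not> ?thesis"
    then have "x = 0\<^sub>v N"
      using x'(1) by (intro eq_vecI) auto
    then show False
      using x'(2) by simp
  qed
  moreover have "z * vec_index x i = (\<Sum>j<N. A $$ (i, j) *\<^sub>R vec_index x j)" if "i < N" for i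
    using mult_mat_vec_of_real_index[OF carr x'(1) that] x'(1,3) that by simp
  ultimately have "stochastic_multiplier N z (\<lambda>i j. A $$ (i, j)) (vec_index x)"
    using A by (simp add: stochastic_multiplier_def row_stochastic_def)
  then show "\<exists>a v. stochastic_multiplier N z a v"
    by blast
next
  assume "\<exists>a v. stochastic_multiplier N z a v"
  then obtain a v where av: "stochastic_multiplier N z a v"
    by blast
  define A where "A = mat N N (\<lambda>(i, j). a i j)"
  define x where "x = Matrix.vec N v"
  have carr: "A \<in> carrier_mat N N" "x \<in> carrier_vec N"
    by (simp_all add: A_def x_def)
  have "row_stochastic N A"
    using av by (simp add: row_stochastic_def stochastic_multiplier_def A_def)
  moreover have "eigenvector (map_mat complex_of_real A) x z"
  proof -
    have "map_mat complex_of_real A *\<^sub>v x = z \<cdot>\<^sub>v x"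
    proof (rule eq_vecI)
      fix i assume "i < dim_vec (z \<cdot>\<^sub>v x)"
      then have i: "i < N"
        by (simp add: x_def)
      have "vec_index (map_mat complex_of_real A *\<^sub>v x) i = (\<Sum>j<N. a i j *\<^sub>R v j)"
        unfolding mult_mat_vec_of_real_index[OF carr i] using i by (simp add: A_def x_def)
      also have "\<dots> = vec_index (z \<cdot>\<^sub>v x) i"
        using av i by (simp add: stochastic_multiplier_def x_def)
      finally show "vec_index (map_mat complex_of_real A *\<^sub>v x) i = vec_index (z \<cdot>\<^sub>v x) i" .
    qed (simp add: A_def x_def)
    moreover obtain i where i: "i < N" "v i \<noteq> 0"
      using av by (auto simp: stochastic_multiplier_def)
    moreover have "x \<noteq> 0\<^sub>v N"
    proof
      assume "x = 0\<^sub>v N"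
      then have "vec_index x i = 0"
        using i by simp
      then show False
        using i by (simp add: x_def)
    qed
    ultimately show ?thesis
      using carr by (auto simp: eigenvector_def)
  qed
  ultimately show "z \<in> Theta_stoch N"
    unfolding Theta_stoch_def eigenvalue_def by blast
qed

text \<open>The list f may repeat points; g selects one index for each point, so that coefficients
  on points can be placed on indices without counting any of them twice.\<close>

lemma sum_over_section:
  fixes F :: "'a \<Rightarrow> 'b :: comm_monoid_add" and N :: nat
  assumes "f ` {..<N} = V" and "\<And>w. w \<in> V \<Longrightarrow> g w < N \<and> f (g w) = w"
  shows "(\<Sum>j<N. if j = g (f j) then F (f j) else 0) = (\<Sum>w\<in>V. F w)"
proof -
  have "(\<Sum>j<N. if j = g (f j) then F (f j) else 0) = (\<Sum>j\<in>{j\<in>{..<N}. j = g (f j)}. F (f j))"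
    by (rule sum.inter_filter[symmetric]) simp
  also have "\<dots> = (\<Sum>w\<in>V. F w)"
    by (rule sum.reindex_bij_witness[of _ g f]) (use assms in auto)
  finally show ?thesis .
qed

lemma polygon_multiplier_iff:
  "polygon_multiplier N z \<longleftrightarrow> (\<exists>a v. stochastic_multiplier N z a v)"
proof
  assume "polygon_multiplier N z"
  then obtain V where V: "finite V" "card V \<le> N" "\<not> V \<subseteq> {0}" "\<forall>v\<in>V. z * v \<in> convex hull V"
    unfolding polygon_multiplier_def by blast
  obtain v0 where v0: "v0 \<in> V" "v0 \<noteq> 0"
    using V(3) by blast
  obtain h where h: "bij_betw h {0..<card V} V"
    using ex_bij_betw_nat_finite[OF V(1)] by blast
  \<comment> \<open>When V has fewer than N points, the list is padded with copies of v0.\<close>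
  define f where "f i = (if i < card V then h i else v0)" for i
  have f: "f ` {..<N} = V"
  proof
    show "f ` {..<N} \<subseteq> V"
      using h v0 by (auto simp: f_def bij_betw_def)
    show "V \<subseteq> f ` {..<N}"
    proof
      fix w assume "w \<in> V"
      then obtain i where "i < card V" "w = h i"
        using h unfolding bij_betw_def by (metis atLeastLessThan_iff imageE)
      then show "w \<in> f ` {..<N}"
        using V(2) by (intro image_eqI[of _ _ i]) (auto simp: f_def)
    qed
  qed
  define g where "g = inv_into {..<N} f"
  have g: "g w < N \<and> f (g w) = w" if "w \<in> V" for w
    using that f inv_into_into[of w f "{..<N}"] f_inv_into_f[of w f "{..<N}"] by (auto simp: g_def)
  have "\<forall>w\<in>V. \<exists>u. (\<forall>x\<in>V. 0 \<le> u x) \<and> sum u V = 1 \<and> (\<Sum>x\<in>V. u x *\<^sub>R x) = z * w"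
    using V(4) unfolding convex_hull_finite[OF V(1)] by blast
  then obtain u where u: "\<And>w x. w \<in> V \<Longrightarrow> x \<in> V \<Longrightarrow> 0 \<le> u w x"
      "\<And>w. w \<in> V \<Longrightarrow> sum (u w) V = 1" "\<And>w. w \<in> V \<Longrightarrow> (\<Sum>x\<in>V. u w x *\<^sub>R x) = z * w"
    by metis
  define a where "a i j = (if j = g (f j) then u (f i) (f j) else 0)" for i j
  have fV: "f i \<in> V" if "i < N" for i
    using f that by auto
  have "stochastic_multiplier N z a f"
    unfolding stochastic_multiplier_def
  proof (intro conjI allI impI)
    fix i assume i: "i < N"
    show "0 \<le> a i j" if "j < N" for j
      using u(1) fV i that by (simp add: a_def)
    show "(\<Sum>j<N. a i j) = 1"
      using sum_over_section[OF f g, of "u (f i)"] u(2)[OF fV[OF i]] by (simp add: a_def)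
    have "(\<Sum>j<N. a i j *\<^sub>R f j) = (\<Sum>j<N. if j = g (f j) then u (f i) (f j) *\<^sub>R f j else 0)"
      by (rule sum.cong) (auto simp: a_def)
    also have "\<dots> = z * f i"
      using sum_over_section[OF f g, of "\<lambda>x. u (f i) x *\<^sub>R x"] u(3)[OF fV[OF i]] by simp
    finally show "z * f i = (\<Sum>j<N. a i j *\<^sub>R f j)"
      by simp
  next
    show "\<exists>i<N. f i \<noteq> 0"
      using g[OF v0(1)] v0(2) by (intro exI[of _ "g v0"]) auto
  qed
  then show "\<exists>a v. stochastic_multiplier N z a v"
    by blast
next
  assume "\<exists>a v. stochastic_multiplier N z a v"
  then obtain a v where av: "stochastic_multiplier N z a v"
    by blast
  have "z * v i \<in> convex hull (v ` {..<N})" if "i < N" for i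
  proof -
    have "(\<Sum>j<N. a i j *\<^sub>R v j) \<in> convex hull (v ` {..<N})"
      using av that by (intro convex_sum) (auto simp: stochastic_multiplier_def intro: hull_inc)
    then show ?thesis
      using av that by (simp add: stochastic_multiplier_def)
  qed
  moreover have "card (v ` {..<N}) \<le> N"
    using card_image_le[of "{..<N}" v] by simp
  moreover have "\<not> v ` {..<N} \<subseteq> {0}"
    using av by (auto simp: stochastic_multiplier_def)
  ultimately show "polygon_multiplier N z"
    unfolding polygon_multiplier_def by (intro exI[of _ "v ` {..<N}"]) auto
qed

section \<open>Existence of the largest modulus on a ray\<close>

lemma compact_Pi_UNIV:
  fixes K :: "'a \<Rightarrow> 'b :: topological_space set"
  assumes "\<And>i. compact (K i)"
  shows "compact (Pi UNIV K)"
  using compactin_PiE[of "\<lambda>_. euclidean" UNIV K] assms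
  by (simp add: euclidean_product_topology compactin_euclidean_iff PiE_UNIV_domain)

text \<open>Normalizing the sum of the norms replaces the condition that v be nonzero, which limits
  can violate, by a closed one, and bounds all data. Entries outside the index range become 0, so
  that even the total functions lie in a compact product.\<close>

lemma stochastic_multiplier_normalized:
  assumes "stochastic_multiplier N z a v"
  obtains b w where "stochastic_multiplier N z b w" "\<And>i j. b i j \<in> {0..1}"
    "\<And>i. w i \<in> cball 0 1" "(\<Sum>i<N. norm (w i)) = 1"
proof -
  define s where "s = (\<Sum>i<N. norm (v i))"
  obtain i0 where i0: "i0 < N" "v i0 \<noteq> 0"
    using assms by (auto simp: stochastic_multiplier_def)
  have "norm (v i) \<le> s" if "i < N" for i
    unfolding s_def using that by (intro member_le_sum) auto
  moreover from this[of i0] have s: "0 < s"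
    using i0 by (smt (verit) zero_less_norm_iff)
  ultimately have le: "norm (v i) / s \<le> 1" if "i < N" for i
    using that by simp
  define b where "b i j = (if i < N \<and> j < N then a i j else 0)" for i j
  define w where "w i = (if i < N then v i / of_real s else 0)" for i
  have "z * (v i / of_real s) = (\<Sum>j<N. a i j *\<^sub>R (v j / of_real s))" if "i < N" for i
    using assms that
    by (simp add: stochastic_multiplier_def scaleR_conv_of_real sum_divide_distrib mult.assoc
        flip: times_divide_eq_right)
       (simp add: sum_divide_distrib)
  then have "stochastic_multiplier N z b w"
    using assms s unfolding stochastic_multiplier_def b_def w_def
    by (simp cong: conj_cong)
  moreover have "b i j \<in> {0..1}" for i j
  proof (cases "i < N \<and> j < N")
    case True
    then have "a i j \<le> (\<Sum>j<N. a i j)"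
      using assms by (intro member_le_sum) (auto simp: stochastic_multiplier_def)
    then show ?thesis
      using assms True by (auto simp: stochastic_multiplier_def b_def)
  qed (auto simp: b_def)
  moreover have "w i \<in> cball 0 1" for i
    using le[of i] s by (simp add: w_def norm_divide)
  moreover have "(\<Sum>i<N. norm (w i)) = 1"
  proof -
    have "(\<Sum>i<N. norm (w i)) = (\<Sum>i<N. norm (v i) / s)"
      using s by (intro sum.cong) (auto simp: w_def norm_divide)
    also have "\<dots> = 1"
      using s by (simp add: s_def flip: sum_divide_distrib)
    finally show ?thesis .
  qed
  ultimately show ?thesis
    by (rule that)
qed

text \<open>The set is the projection of a compact set of triples (modulus, matrix, vector): a
  closed set given by the equations inside a product of compact sets. By normalization, no
  multiplier is lost.\<close>

lemma compact_ray_multipliers: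
  "compact {r. r \<in> {0..1} \<and> (\<exists>a v. stochastic_multiplier N (rcis r \<theta>) a v)}"
proof -
  define B where "B = {0..1::real} \<times>
    Pi UNIV (\<lambda>_::nat \<times> nat. {0..1::real}) \<times> Pi UNIV (\<lambda>_::nat. cball (0::complex) 1)"
  define S where "S = {p. (\<forall>i\<in>{..<N}. (\<Sum>j<N. fst (snd p) (i, j)) = (1::real)) \<and>
    (\<Sum>i<N. norm (snd (snd p) i)) = 1 \<and>
    (\<forall>i\<in>{..<N}. rcis (fst p) \<theta> * snd (snd p) i = (\<Sum>j<N. fst (snd p) (i, j) *\<^sub>R (snd (snd p) j :: complex)))}"
  have "compact B"
    unfolding B_def by (intro compact_Times compact_Pi_UNIV) auto
  moreover have "closed S"
  proof -
    have 1: "continuous_on UNIV (\<lambda>p :: real \<times> (nat \<times> nat \<Rightarrow> real) \<times> (nat \<Rightarrow> complex). fst (snd p) k)" for k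
      by (rule continuous_on_compose2[OF continuous_on_product_coordinates[of k]])
         (simp_all add: continuous_on_fst continuous_on_snd)
    have 2: "continuous_on UNIV (\<lambda>p :: real \<times> (nat \<times> nat \<Rightarrow> real) \<times> (nat \<Rightarrow> complex). snd (snd p) k)" for k
      by (rule continuous_on_compose2[OF continuous_on_product_coordinates[of k]])
         (simp_all add: continuous_on_fst continuous_on_snd)
    have "S = (\<Inter>i\<in>{..<N}. {p. (\<Sum>j<N. fst (snd p) (i, j)) = 1}) \<inter>
        {p. (\<Sum>i<N. norm (snd (snd p) i)) = 1} \<inter>
        (\<Inter>i\<in>{..<N}. {p. rcis (fst p) \<theta> * snd (snd p) i = (\<Sum>j<N. fst (snd p) (i, j) *\<^sub>R snd (snd p) j)})"
      by (auto simp: S_def)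
    also have "closed \<dots>"
    proof (intro closed_Int closed_INT ballI)
      fix i
      show "closed {p :: real \<times> (nat \<times> nat \<Rightarrow> real) \<times> (nat \<Rightarrow> complex). (\<Sum>j<N. fst (snd p) (i, j)) = 1}"
        by (intro closed_Collect_eq continuous_on_sum continuous_on_const 1)
      show "closed {p :: real \<times> (nat \<times> nat \<Rightarrow> real) \<times> (nat \<Rightarrow> complex). (\<Sum>i<N. norm (snd (snd p) i)) = 1}"
        by (intro closed_Collect_eq continuous_on_sum continuous_on_const continuous_on_norm 2)
      show "closed {p. rcis (fst p) \<theta> * snd (snd p) i = (\<Sum>j<N. fst (snd p) (i, j) *\<^sub>R snd (snd p) j)}"
        unfolding rcis_def
        by (intro closed_Collect_eq continuous_on_sum continuous_on_mult continuous_on_scaleR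
            continuous_on_of_real continuous_on_fst continuous_on_id continuous_on_const 1 2)
    qed
    finally show ?thesis .
  qed
  ultimately have "compact (fst ` (B \<inter> S))"
    by (intro compact_continuous_image continuous_intros compact_Int_closed)
  also have "fst ` (B \<inter> S) = {r. r \<in> {0..1} \<and> (\<exists>a v. stochastic_multiplier N (rcis r \<theta>) a v)}"
  proof (intro subset_antisym subsetI)
    fix r assume "r \<in> fst ` (B \<inter> S)"
    then obtain a v where r: "(r, a, v) \<in> B" "(r, a, v) \<in> S"
      by force
    have "\<exists>i<N. v i \<noteq> 0"
    proof (rule ccontr)
      assume "\<not> ?thesis"
      then have "(\<Sum>i<N. norm (v i)) = 0"
        by simp
      then show False
        using r(2) by (simp add: S_def)
    qed
    then have "stochastic_multiplier N (rcis r \<theta>) (\<lambda>i j. a (i, j)) v"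
      using r by (auto simp: stochastic_multiplier_def B_def S_def Pi_def)
    then show "r \<in> {r. r \<in> {0..1} \<and> (\<exists>a v. stochastic_multiplier N (rcis r \<theta>) a v)}"
      using r(1) by (auto simp: B_def)
  next
    fix r assume "r \<in> {r. r \<in> {0..1} \<and> (\<exists>a v. stochastic_multiplier N (rcis r \<theta>) a v)}"
    then obtain a v where r: "r \<in> {0..1}" and "stochastic_multiplier N (rcis r \<theta>) a v"
      by blast
    then obtain b w where bw: "stochastic_multiplier N (rcis r \<theta>) b w" "\<And>i j. b i j \<in> {0..1}"
        "\<And>i. w i \<in> cball 0 1" "(\<Sum>i<N. norm (w i)) = 1"
      using stochastic_multiplier_normalized by metis
    have "(r, (\<lambda>(i, j). b i j), w) \<in> B \<inter> S"
      using r bw by (auto simp: B_def S_def stochastic_multiplier_def)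
    then show "r \<in> fst ` (B \<inter> S)"
      by (intro image_eqI) auto
  qed
  finally show ?thesis .
qed

lemma polygon_multiplier_zero:
  assumes "2 \<le> N" shows "polygon_multiplier N 0"
proof -
  have "0 \<in> convex hull {1, - 1 :: complex}"
    unfolding convex_hull_2 by (simp, intro exI[of _ "1/2"] conjI exI[of _ "1/2"]) auto
  then show ?thesis
    unfolding polygon_multiplier_def using assms by (intro exI[of _ "{1, - 1}"]) auto
qed

text \<open>Compactness provides a maximum, which identifies the \<open>GREATEST\<close>. The bound
  2 on N serves the multiplier 0, whose set of points is \<open>{1, - 1}\<close>.\<close>

lemma K_radius_greatest:
  assumes "2 \<le> N"
  shows "0 \<le> K_radius N \<theta>" and "polygon_multiplier N (rcis (K_radius N \<theta>) \<theta>)"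
    and "\<And>r. 0 \<le> r \<Longrightarrow> polygon_multiplier N (rcis r \<theta>) \<Longrightarrow> r \<le> K_radius N \<theta>"
proof -
  let ?P = "\<lambda>r. 0 \<le> r \<and> polygon_multiplier N (rcis r \<theta>)"
  let ?R = "{r. r \<in> {0..1} \<and> (\<exists>a v. stochastic_multiplier N (rcis r \<theta>) a v)}"
  have le1: "r \<le> 1" if "?P r" for r
    using polygon_multiplier_norm_le[of N "rcis r \<theta>"] that by simp
  then have R: "?R = {r. ?P r}"
    by (auto simp: polygon_multiplier_iff)
  have "0 \<in> ?R"
    using polygon_multiplier_zero[OF assms] unfolding R by (simp add: rcis_def)
  then obtain s where s: "?P s" "\<And>r. ?P r \<Longrightarrow> r \<le> s"
    using compact_attains_sup[OF compact_ray_multipliers[of N \<theta>]] unfolding R by blast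
  have "K_radius N \<theta> = (GREATEST r. ?P r)"
    by (simp add: K_radius_def Theta_stoch_iff polygon_multiplier_iff rcis_def)
  also have "\<dots> = s"
    by (rule Greatest_equality) (use s in auto)
  finally have K: "K_radius N \<theta> = s" .
  show "0 \<le> K_radius N \<theta>" "polygon_multiplier N (rcis (K_radius N \<theta>) \<theta>)"
    "\<And>r. 0 \<le> r \<Longrightarrow> polygon_multiplier N (rcis r \<theta>) \<Longrightarrow> r \<le> K_radius N \<theta>"
    using s unfolding K by auto
qed

section \<open>Regular polygons\<close>

text \<open>The chord from 1 to \<open>cis (2 * \<beta>)\<close> has distance
  \<open>cos \<beta>\<close> from 0 and normal direction \<beta>, whence the modulus of its point in
  direction t.\<close>

lemma chord_point:
  assumes "0 < \<beta>" "\<beta> < pi / 2" "0 \<le> t" "t \<le> 2 * \<beta>"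
  obtains u where "0 \<le> u" "u \<le> 1"
    "rcis (cos \<beta> / cos (\<beta> - t)) t = (1 - u) *\<^sub>R 1 + u *\<^sub>R cis (2 * \<beta>)"
proof -
  \<comment> \<open>Obtained by comparing imaginary parts. The denominator equals
    \<open>sin (2 * \<beta> - t) + sin t\<close>, which gives \<open>u \<le> 1\<close>.\<close>
  define u where "u = sin t / (2 * sin \<beta> * cos (\<beta> - t))"
  have sb: "0 < sin \<beta>" and cb: "0 < cos (\<beta> - t)"
    using assms by (auto intro!: sin_gt_zero cos_gt_zero_pi)
  have "0 \<le> sin t" "0 \<le> sin (2 * \<beta> - t)"
    using assms by (auto intro!: sin_ge_zero)
  moreover have "2 * sin \<beta> * cos (\<beta> - t) = sin (2 * \<beta> - t) + sin t"
    using sin_times_cos[of \<beta> "\<beta> - t"] by (simp add: field_simps)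
  moreover have "0 < 2 * sin \<beta> * cos (\<beta> - t)"
    using sb cb by simp
  ultimately have "0 \<le> u" "u \<le> 1"
    unfolding u_def by (simp_all only: divide_le_eq_1_pos divide_nonneg_pos)
  moreover have "cos \<beta> / cos (\<beta> - t) * cos t = 1 - u + u * cos (2 * \<beta>)"
  proof -
    have "1 - u + u * cos (2 * \<beta>) = 1 - 2 * (sin \<beta>)\<^sup>2 * u"
      by (simp only: cos_double_sin) (simp add: algebra_simps)
    also have "2 * (sin \<beta>)\<^sup>2 * u = sin \<beta> * sin t / cos (\<beta> - t)"
      using sb cb by (simp add: u_def power2_eq_square)
    also have "1 - \<dots> = (cos (\<beta> - t) - sin \<beta> * sin t) / cos (\<beta> - t)"
      using cb by (simp add: diff_divide_distrib)
    finally show ?thesis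
      by (simp add: cos_diff)
  qed
  moreover have "cos \<beta> / cos (\<beta> - t) * sin t = u * sin (2 * \<beta>)"
    using sb cb by (simp add: u_def sin_double)
  ultimately show ?thesis
    using that by (simp add: complex_eq_iff)
qed

text \<open>Each vertex of the regular q-gon is turned by p vertices and then moved along an
  adjacent edge, to the point of that edge in direction \<delta>.\<close>

lemma regular_polygon_multiplier:
  fixes p :: int
  assumes q: "3 \<le> q" "q \<le> N" and \<delta>: "\<bar>\<delta>\<bar> \<le> 2 * (pi / real q)"
    and \<theta>: "\<theta> = 2 * pi * (of_int p / real q) + \<delta>"
  shows "polygon_multiplier N (rcis (cos (pi / real q) / cos (pi / real q - \<bar>\<delta>\<bar>)) \<theta>)"
proof -
  define \<beta> where "\<beta> = pi / real q"
  define w where "w k = cis (2 * pi * (of_int k / real q))" for k :: int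
  define V where "V = (\<lambda>k. w (int k)) ` {..<q}"
  have \<beta>: "0 < \<beta>" "\<beta> < pi / 2"
    using q by (auto simp: \<beta>_def field_simps)
  have w_add: "w (k + l) = w k * w l" for k l
    by (simp add: w_def cis_mult algebra_simps add_divide_distrib)
  have wV: "w k \<in> V" for k
  proof -
    have "w (int q * (k div int q)) = cis (2 * pi * of_int (k div int q))"
      using q by (simp add: w_def)
    then have "w (int q * (k div int q)) = 1"
      by simp
    then have "w k = w (k mod int q)"
      using w_add[of "int q * (k div int q)" "k mod int q"] by simp
    moreover have "0 \<le> k mod int q" "k mod int q < int q"
      using q by simp_all
    ultimately show ?thesis
      unfolding V_def by (intro image_eqI[of _ _ "nat (k mod int q)"]) auto
  qed
  obtain u where u: "0 \<le> u" "u \<le> 1" and chord: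
      "rcis (cos \<beta> / cos (\<beta> - \<bar>\<delta>\<bar>)) \<bar>\<delta>\<bar> = (1 - u) *\<^sub>R 1 + u *\<^sub>R cis (2 * \<beta>)"
    using chord_point[of \<beta> "\<bar>\<delta>\<bar>"] \<beta> \<delta> by (auto simp: \<beta>_def)
  \<comment> \<open>The sign of \<delta> decides which of the two adjacent edges is used; the
    clockwise case follows by conjugation.\<close>
  define e :: int where "e = (if 0 \<le> \<delta> then 1 else - 1)"
  have chord': "rcis (cos \<beta> / cos (\<beta> - \<bar>\<delta>\<bar>)) \<delta> = (1 - u) *\<^sub>R 1 + u *\<^sub>R w e"
  proof (cases "0 \<le> \<delta>")
    case True
    then show ?thesis
      using chord by (simp add: e_def w_def \<beta>_def)
  next
    case False
    then have "rcis (cos \<beta> / cos (\<beta> - \<bar>\<delta>\<bar>)) \<delta> = cnj (rcis (cos \<beta> / cos (\<beta> - \<bar>\<delta>\<bar>)) \<bar>\<delta>\<bar>)"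
      by (simp add: rcis_def cis_cnj)
    also have "\<dots> = (1 - u) *\<^sub>R 1 + u *\<^sub>R w e"
      unfolding chord using False by (simp add: e_def w_def \<beta>_def cis_cnj)
    finally show ?thesis .
  qed
  have "rcis (cos \<beta> / cos (\<beta> - \<bar>\<delta>\<bar>)) \<theta> * w k \<in> convex hull V" for k
  proof -
    have "rcis (cos \<beta> / cos (\<beta> - \<bar>\<delta>\<bar>)) \<theta> = w p * rcis (cos \<beta> / cos (\<beta> - \<bar>\<delta>\<bar>)) \<delta>"
      by (simp add: \<theta> w_def rcis_def flip: cis_mult)
    also have "\<dots> * w k = (1 - u) *\<^sub>R w (p + k) + u *\<^sub>R w (p + k + e)"
      unfolding chord' by (simp add: w_add algebra_simps)
    also have "\<dots> \<in> convex hull V"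
      using u wV hull_inc[of _ V] by (intro convexD[OF convex_convex_hull]) auto
    finally show ?thesis .
  qed
  then have "\<forall>v\<in>V. rcis (cos \<beta> / cos (\<beta> - \<bar>\<delta>\<bar>)) \<theta> * v \<in> convex hull V"
    by (auto simp: V_def)
  moreover have "card V \<le> N"
    using card_image_le[of "{..<q}" "\<lambda>k. w (int k)"] q by (simp add: V_def)
  moreover have "w 0 \<noteq> 0"
    by (simp add: w_def)
  then have "\<not> V \<subseteq> {0}"
    using wV[of 0] by blast
  ultimately show ?thesis
    unfolding polygon_multiplier_def \<beta>_def by (intro exI[of _ V]) (auto simp: V_def)
qed

lemma K_radius_ge_regular:
  fixes p :: int
  assumes "3 \<le> q" "q \<le> N" "\<bar>\<delta>\<bar> \<le> 2 * (pi / real q)"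
    and "\<theta> = 2 * pi * (of_int p / real q) + \<delta>"
  shows "cos (pi / real q) / cos (pi / real q - \<bar>\<delta>\<bar>) \<le> K_radius N \<theta>"
proof (rule K_radius_greatest(3))
  have "0 < pi / real q" "pi / real q < pi / 2"
    using assms by (auto simp: field_simps)
  then have "0 < cos (pi / real q)" "0 < cos (pi / real q - \<bar>\<delta>\<bar>)"
    using assms by (auto intro!: cos_gt_zero cos_gt_zero_pi)
  then show "0 \<le> cos (pi / real q) / cos (pi / real q - \<bar>\<delta>\<bar>)"
    by simp
qed (use assms regular_polygon_multiplier[OF assms] in auto)

lemma cos_pi_div_ge_half:
  assumes "3 \<le> q" shows "1 / 2 \<le> cos (pi / real q)"
proof -
  have "cos (pi / 3) \<le> cos (pi / real q)"
    using assms by (intro cos_monotone_0_pi_le divide_left_mono) (auto simp: field_simps)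
  then show ?thesis
    by (simp add: cos_60)
qed

text \<open>The regular N-gon serves every angle, as \<open>cos (pi / N)\<close> is its inradius and
  no point of an edge is closer to 0.\<close>

lemma K_radius_ge_cos:
  assumes "3 \<le> N" shows "cos (pi / real N) \<le> K_radius N \<theta>"
proof -
  define p where "p = \<lfloor>\<theta> / (2 * (pi / real N))\<rfloor>"
  define \<delta> where "\<delta> = \<theta> - of_int p * (2 * (pi / real N))"
  have N: "0 < 2 * (pi / real N)"
    using assms by simp
  have "of_int p \<le> \<theta> / (2 * (pi / real N))" "\<theta> / (2 * (pi / real N)) < of_int p + 1"
    unfolding p_def by linarith+
  then have "of_int p * (2 * (pi / real N)) \<le> \<theta>" "\<theta> < (of_int p + 1) * (2 * (pi / real N))"
    using N by (simp_all only: pos_le_divide_eq pos_divide_less_eq)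
  then have \<delta>: "0 \<le> \<delta>" "\<delta> < 2 * (pi / real N)"
    unfolding \<delta>_def by (simp_all only: distrib_right)
  have "pi / real N < pi / 2"
    using assms by (simp add: field_simps)
  then have "0 < cos (pi / real N - \<bar>\<delta>\<bar>)"
    using \<delta> by (intro cos_gt_zero_pi) auto
  moreover have "0 < cos (pi / real N)"
    using cos_pi_div_ge_half[OF assms] by simp
  ultimately have "cos (pi / real N) \<le> cos (pi / real N) / cos (pi / real N - \<bar>\<delta>\<bar>)"
    by (simp add: pos_le_divide_eq)
  also have "\<dots> \<le> K_radius N \<theta>"
    using assms \<delta> by (intro K_radius_ge_regular[where p = p]) (auto simp: \<delta>_def algebra_simps)
  finally show ?thesis .
qed

lemma K_radius_pos:
  assumes "3 \<le> N" shows "0 < K_radius N \<theta>"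
  using K_radius_ge_cos[OF assms, of \<theta>] cos_pi_div_ge_half[OF assms] by simp

lemma K_radius_le_1:
  assumes "2 \<le> N" shows "K_radius N \<theta> \<le> 1"
  using polygon_multiplier_norm_le[OF K_radius_greatest(2)[OF assms, of \<theta>]]
    K_radius_greatest(1)[OF assms, of \<theta>] by simp

lemma K_radius_eq_1_iff:
  assumes "2 \<le> N" shows "K_radius N \<theta> = 1 \<longleftrightarrow> polygon_multiplier N (cis \<theta>)"
  using K_radius_greatest(2)[OF assms, of \<theta>] K_radius_greatest(3)[OF assms, of 1 \<theta>]
    K_radius_le_1[OF assms, of \<theta>]
  by (auto simp: cis_rcis_eq)

text \<open>The rotation permutes the b-th roots of unity. This includes b = 1 and b = 2, where the
  hull is a point or a segment.\<close>

lemma rational_rotation_multiplier: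
  fixes a b :: int
  assumes "1 \<le> b" "b \<le> int N"
  shows "polygon_multiplier N (cis (2 * pi * (of_int a / of_int b)))"
proof -
  define q where "q = nat b"
  have q: "0 < q" "q \<le> N" "of_int b = real q"
    using assms by (auto simp: q_def)
  define V where "V = {z :: complex. z ^ q = 1}"
  have "cis (2 * pi * (of_int a / of_int b)) ^ q = cis (2 * pi * of_int a)"
    using q by (simp add: Complex.DeMoivre field_simps)
  also have "\<dots> = 1"
    by simp
  finally have "\<forall>v\<in>V. cis (2 * pi * (of_int a / of_int b)) * v \<in> convex hull V"
    by (auto simp: V_def power_mult_distrib intro!: hull_inc)
  moreover have "1 \<in> V"
    by (simp add: V_def)
  moreover have "finite V" "card V \<le> N"
    using q card_roots_unity_eq[of q] finite_roots_unity[of q] by (auto simp: V_def)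
  ultimately show ?thesis
    unfolding polygon_multiplier_def by (intro exI[of _ V]) auto
qed

lemma K_radius_le_first_arc:
  assumes "3 \<le> N" "0 < t" "t < pi"
  shows "K_radius N t * cos (t - pi / real N) \<le> cos (pi / real N)"
  using assms K_radius_pos[of N t] by (intro multiplier_first_arc K_radius_greatest(2)) auto

text \<open>This direction points to the middle of the first chord, where the bound of the first arc
  meets the inradius of the regular N-gon.\<close>

lemma K_radius_pi_div:
  assumes "3 \<le> N" shows "K_radius N (pi / real N) = cos (pi / real N)"
proof -
  have "0 < pi / real N" "pi / real N < pi"
    using assms by (auto simp: field_simps)
  then show ?thesis
    using K_radius_le_first_arc[OF assms, of "pi / real N"] K_radius_ge_cos[OF assms, of "pi / real N"]
    by simp
qed

section \<open>The expansion factor\<close>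

definition plane_of_complex :: "complex \<Rightarrow> real^2" where
  "plane_of_complex z = vector [Re z, Im z]"

definition complex_of_plane :: "real^2 \<Rightarrow> complex" where
  "complex_of_plane x = Complex (x $ 1) (x $ 2)"

lemma complex_of_plane_of_complex [simp]: "complex_of_plane (plane_of_complex z) = z"
  by (simp add: complex_of_plane_def plane_of_complex_def)

lemma plane_of_complex_of_plane [simp]: "plane_of_complex (complex_of_plane x) = x"
  by (simp add: complex_of_plane_def plane_of_complex_def Finite_Cartesian_Product.vec_eq_iff forall_2)

lemma linear_plane_of_complex: "linear plane_of_complex"
  by (intro linearI) (simp_all add: plane_of_complex_def Finite_Cartesian_Product.vec_eq_iff forall_2)

lemma linear_complex_of_plane: "linear complex_of_plane"
  by (intro linearI) (simp_all add: complex_of_plane_def complex_eq_iff)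

lemma bij_plane_of_complex: "bij plane_of_complex"
  by (rule bij_betw_byWitness[of _ complex_of_plane]) auto

lemma complex_of_plane_scaled_rotation:
  "complex_of_plane (scaled_rotation \<rho> \<theta> x) = rcis \<rho> \<theta> * complex_of_plane x"
  by (simp add: complex_of_plane_def scaled_rotation_def rotation_def complex_eq_iff
      matrix_vector_mult_def sum_2 algebra_simps)

text \<open>For angles strictly between 0 and pi, every invariant hull has 0 in its interior. At 0
  and pi an optimal V may be degenerate; a square, invariant under both signs, takes its place and
  accounts for the bound 4 on N.\<close>

lemma optimal_polygon_exists:
  assumes N: "4 \<le> N" and \<theta>: "\<theta> \<in> {0..pi}"
  obtains V where "finite V" "card V \<le> N" "0 \<in> interior (convex hull V)"
    "\<forall>v\<in>V. rcis (K_radius N \<theta>) \<theta> * v \<in> convex hull V"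
proof (cases "\<theta> = 0 \<or> \<theta> = pi")
  case True
  define V where "V = {1, \<i>, - 1, - \<i>}"
  have V: "finite V" "\<not> V \<subseteq> {0}" "card V \<le> N"
    using N by (auto simp: V_def card_insert_if)
  \<comment> \<open>The square is also invariant under a quarter turn, whose angle is admissible for
    the criterion on interior points.\<close>
  have "\<forall>v\<in>V. rcis 1 (pi / 2) * v \<in> convex hull V"
    by (auto simp: V_def rcis_def cis_pi_half intro!: hull_inc)
  then have int0: "0 \<in> interior (convex hull V)"
    using V by (intro zero_in_interior_multiplier_hull[of V 1 "pi / 2"]) auto
  have inv: "\<forall>v\<in>V. cis \<theta> * v \<in> convex hull V"
    using True by (auto simp: V_def intro!: hull_inc)
  then have "polygon_multiplier N (cis \<theta>)"
    unfolding polygon_multiplier_def using V by blast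
  then have "K_radius N \<theta> = 1"
    using N by (simp add: K_radius_eq_1_iff)
  then show ?thesis
    using that[of V] V int0 inv by (simp add: cis_rcis_eq)
next
  case False
  then have "0 < \<theta>" "\<theta> < pi"
    using \<theta> by auto
  moreover obtain V where "finite V" "card V \<le> N" "\<not> V \<subseteq> {0}"
      "\<forall>v\<in>V. rcis (K_radius N \<theta>) \<theta> * v \<in> convex hull V"
    using K_radius_greatest(2)[of N \<theta>] N unfolding polygon_multiplier_def by auto
  ultimately show ?thesis
    using zero_in_interior_multiplier_hull[of V "K_radius N \<theta>" \<theta>] K_radius_pos[of N \<theta>] N that
    by simp
qed

lemma polygon_expansion_ge:
  assumes P: "polytope P" "card {v. v extreme_point_of P} \<le> N" "0 \<in> interior P"
    and T: "scaled_rotation \<rho> \<theta> ` P \<subseteq> (\<lambda>p. \<gamma> *\<^sub>R p) ` P"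
    and "0 < \<gamma>" "0 < \<rho>"
  shows "polygon_multiplier N (rcis (\<rho> / \<gamma>) \<theta>)"
proof -
  define E where "E = {v. v extreme_point_of P}"
  define V where "V = complex_of_plane ` E"
  have finE: "finite E"
    using P(1) by (simp add: E_def finite_polyhedron_extreme_points polytope_imp_polyhedron)
  have PE: "P = convex hull E"
    unfolding E_def using P(1)
    by (intro Krein_Milman_Minkowski polytope_imp_compact polytope_imp_convex)
  have hullV: "complex_of_plane ` P = convex hull V"
    unfolding V_def PE by (rule convex_hull_linear_image[OF linear_complex_of_plane])
  have "rcis (\<rho> / \<gamma>) \<theta> * complex_of_plane v \<in> convex hull V" if "v \<in> E" for v
  proof -
    have "v \<in> P"
      using that by (simp add: E_def extreme_point_of_def)
    then obtain p where p: "p \<in> P" "scaled_rotation \<rho> \<theta> v = \<gamma> *\<^sub>R p"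
      using T by blast
    then have "rcis \<rho> \<theta> * complex_of_plane v = \<gamma> *\<^sub>R complex_of_plane p"
      by (simp add: linear_scale[OF linear_complex_of_plane] flip: complex_of_plane_scaled_rotation)
    then have "complex_of_plane p = rcis (\<rho> / \<gamma>) \<theta> * complex_of_plane v"
      using \<open>0 < \<gamma>\<close> by (simp add: rcis_def scaleR_conv_of_real field_simps)
    then show ?thesis
      using p(1) hullV by (metis image_eqI)
  qed
  moreover have "card V \<le> N"
    using card_image_le[OF finE, of complex_of_plane] P(2) by (simp add: V_def E_def)
  moreover have "\<not> V \<subseteq> {0}"
  proof
    assume "V \<subseteq> {0}"
    then have "complex_of_plane ` P \<subseteq> {0}"
      unfolding hullV using hull_mono[of V "{0}" convex] by simp
    have "x = 0" if "x \<in> P" for x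
    proof -
      have "complex_of_plane x = 0"
        using \<open>complex_of_plane ` P \<subseteq> {0}\<close> that by blast
      then show ?thesis
        using linear_0[OF linear_plane_of_complex] by (metis plane_of_complex_of_plane)
    qed
    moreover obtain e where "e > 0" "e *\<^sub>R (1 :: real^2) \<in> P"
      using interior_zero_small_multiple[OF P(3)] by metis
    ultimately show False
      by fastforce
  qed
  ultimately show ?thesis
    unfolding polygon_multiplier_def using finE by (intro exI[of _ V]) (auto simp: V_def)
qed

text \<open>The infimum is attained: the optimal polygon realizes
  \<open>\<rho> / K_radius N \<theta>\<close>, and an admissible \<gamma> makes
  \<open>\<rho> / \<gamma>\<close> the modulus of a multiplier.\<close>

lemma Gamma_polygon_scaled_rotation:
  assumes N: "4 \<le> N" and \<theta>: "\<theta> \<in> {0..pi}" and \<rho>: "0 < \<rho>"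
  shows "Gamma_polygon N (scaled_rotation \<rho> \<theta>) = \<rho> / K_radius N \<theta>"
  unfolding Gamma_polygon_def
proof (rule cInf_eq_minimum)
  define K where "K = K_radius N \<theta>"
  have K: "0 < K"
    using N by (simp add: K_def K_radius_pos)
  obtain V where V: "finite V" "card V \<le> N" "0 \<in> interior (convex hull V)"
      "\<forall>v\<in>V. rcis K \<theta> * v \<in> convex hull V"
    unfolding K_def by (rule optimal_polygon_exists[OF N \<theta>])
  define P where "P = plane_of_complex ` (convex hull V)"
  have P: "P = convex hull (plane_of_complex ` V)"
    unfolding P_def by (rule convex_hull_linear_image[OF linear_plane_of_complex])
  have "polytope P"
    unfolding P using V(1) by (intro polytope_convex_hull) auto
  moreover have "card {v. v extreme_point_of P} \<le> N"
  proof -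
    have "card {v. v extreme_point_of P} \<le> card (plane_of_complex ` V)"
      unfolding P using V(1) by (intro card_mono extreme_points_of_convex_hull) auto
    then show ?thesis
      using card_image_le[OF V(1), of plane_of_complex] V(2) by linarith
  qed
  moreover have "0 \<in> interior P"
    unfolding P_def interior_bijective_linear_image[OF linear_plane_of_complex bij_plane_of_complex]
    using V(3) linear_0[OF linear_plane_of_complex] by (metis image_eqI)
  moreover have "scaled_rotation \<rho> \<theta> ` P \<subseteq> (\<lambda>p. (\<rho> / K) *\<^sub>R p) ` P"
  proof
    fix y assume "y \<in> scaled_rotation \<rho> \<theta> ` P"
    then obtain w where w: "w \<in> convex hull V" "y = scaled_rotation \<rho> \<theta> (plane_of_complex w)"
      by (auto simp: P_def)
    have "complex_of_plane y = rcis \<rho> \<theta> * w"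
      by (simp add: w(2) complex_of_plane_scaled_rotation)
    also have "\<dots> = (\<rho> / K) *\<^sub>R (rcis K \<theta> * w)"
      using K by (simp add: rcis_def scaleR_conv_of_real)
    finally have "y = (\<rho> / K) *\<^sub>R plane_of_complex (rcis K \<theta> * w)"
      by (metis plane_of_complex_of_plane linear_scale[OF linear_plane_of_complex])
    moreover have "plane_of_complex (rcis K \<theta> * w) \<in> P"
      unfolding P_def using mult_convex_hull_subset[OF V(4) w(1)] by (rule imageI)
    ultimately show "y \<in> (\<lambda>p. (\<rho> / K) *\<^sub>R p) ` P"
      by blast
  qed
  ultimately show "\<rho> / K_radius N \<theta> \<in> {\<gamma>. 0 < \<gamma> \<and> (\<exists>P. polytope P \<and> card {v. v extreme_point_of P} \<le> N \<and>
      0 \<in> interior P \<and> scaled_rotation \<rho> \<theta> ` P \<subseteq> (\<lambda>p. \<gamma> *\<^sub>R p) ` P)}"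
    using K \<rho> unfolding K_def by auto
next
  fix \<gamma> assume "\<gamma> \<in> {\<gamma>. 0 < \<gamma> \<and> (\<exists>P. polytope P \<and> card {v. v extreme_point_of P} \<le> N \<and>
      0 \<in> interior P \<and> scaled_rotation \<rho> \<theta> ` P \<subseteq> (\<lambda>p. \<gamma> *\<^sub>R p) ` P)}"
  then have \<gamma>: "0 < \<gamma>" "polygon_multiplier N (rcis (\<rho> / \<gamma>) \<theta>)"
    using polygon_expansion_ge \<rho> by auto
  then have "\<rho> / \<gamma> \<le> K_radius N \<theta>"
    using \<rho> N by (intro K_radius_greatest(3)) auto
  then show "\<rho> / K_radius N \<theta> \<le> \<gamma>"
    using \<gamma>(1) K_radius_pos[of N \<theta>] N by (simp add: field_simps)
qed

section \<open>Badly approximable angles\<close>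

lemma half_le_sin:
  assumes "0 \<le> (y::real)" "y \<le> pi / 3" shows "y / 2 \<le> sin y"
proof (cases "y = 0")
  case False
  then obtain z where z: "0 < z" "z < y" "sin y - sin 0 = (y - 0) * cos z"
    using MVT2[of 0 y sin cos] assms by auto
  have "cos (pi / 3) \<le> cos z"
    using z assms by (intro cos_monotone_0_pi_le) auto
  then have "1 / 2 \<le> cos z"
    by (simp add: cos_60)
  then show ?thesis
    using z mult_left_mono[of "1/2" "cos z" y] by simp
qed simp

lemma rcis_add_2pi_int: "rcis r (2 * pi * of_int h + y) = rcis r y"
  by (simp add: rcis_def flip: cis_mult)

lemma badly_approximable_dist:
  fixes c x :: real and h k :: int
  assumes bad: "\<forall>a b :: int. 1 \<le> b \<longrightarrow> c / (of_int b)\<^sup>2 \<le> \<bar>x - of_int a / of_int b\<bar>"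
    and "0 < k"
  shows "c / of_int k \<le> \<bar>of_int k * x - of_int h\<bar>"
proof -
  have "c / (of_int k)\<^sup>2 * of_int k \<le> \<bar>x - of_int h / of_int k\<bar> * of_int k"
    using bad \<open>0 < k\<close> by (intro mult_right_mono) auto
  also have "\<dots> = \<bar>(x - of_int h / of_int k) * of_int k\<bar>"
    using \<open>0 < k\<close> by (simp add: abs_mult)
  also have "(x - of_int h / of_int k) * of_int k = of_int k * x - of_int h"
    using \<open>0 < k\<close> by (simp add: field_simps)
  finally show ?thesis
    using \<open>0 < k\<close> by (simp add: power2_eq_square)
qed

text \<open>
  A power \<open>k \<le> 2 * N\<close> of the multiplier, chosen by Dirichlet's theorem, has its angle well inside
  the first arc, so that its modulus is at most \<open>1 - O(N\<^sup>-\<^sup>2)\<close>.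
\<close>

lemma one_minus_K_radius_ge:
  assumes bad: "\<forall>a b :: int. 1 \<le> b \<longrightarrow> c / (of_int b)\<^sup>2 \<le> \<bar>x - of_int a / of_int b\<bar>"
    and c: "0 < c" and N: "3 \<le> N"
  shows "c / 2 / real N ^ 3 \<le> 1 - K_radius N (2 * pi * x)"
proof -
  define K where "K = K_radius N (2 * pi * x)"
  define \<beta> where "\<beta> = pi / real N"
  have K: "0 < K" "K \<le> 1"
    using N by (simp_all add: K_def K_radius_pos K_radius_le_1)
  \<comment> \<open>Dirichlet's theorem is applied with \<open>2 * N\<close> so that t stays below
    \<beta>, half the angle of the first arc.\<close>
  obtain h k where hk: "0 < k" "k \<le> int (2 * N)" "\<bar>of_int k * x - of_int h\<bar> < 1 / real (2 * N)"
    using Dirichlet_approx[of "2 * N" x] N by (metis gr0I mult_eq_0_iff not_numeral_le_zero zero_neq_numeral)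
  define n where "n = nat k"
  have n: "real n = of_int k" "real n \<le> 2 * real N"
    using hk by (simp_all add: n_def)
  define d where "d = of_int k * x - of_int h"
  define t where "t = 2 * pi * \<bar>d\<bar>"
  have "c / (2 * real N) \<le> c / of_int k"
    using c n hk(1) by (intro divide_left_mono) auto
  also have "\<dots> \<le> \<bar>d\<bar>"
    unfolding d_def by (rule badly_approximable_dist[OF bad hk(1)])
  finally have "c / (2 * real N) \<le> \<bar>d\<bar>" .
  then have "2 * pi * (c / (2 * real N)) \<le> t"
    unfolding t_def by (intro mult_left_mono) auto
  then have t_ge: "c * \<beta> \<le> t"
    by (simp add: \<beta>_def field_simps)
  have "t < 2 * pi * (1 / real (2 * N))"
    unfolding t_def d_def using hk(3) by (intro mult_strict_left_mono) auto
  then have t_less: "t < \<beta>"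
    using N by (simp add: \<beta>_def)
  have \<beta>: "0 < \<beta>" "\<beta> \<le> pi / 3"
    using N by (simp_all add: \<beta>_def field_simps)
  have t: "0 < t"
    using t_ge \<beta>(1) c mult_pos_pos[of c \<beta>] by linarith
  have "polygon_multiplier N (rcis (K ^ n) (real n * (2 * pi * x)))"
    using polygon_multiplier_power[OF K_radius_greatest(2)[of N "2 * pi * x"], of n] N
    by (simp add: DeMoivre2 K_def)
  moreover have "real n * (2 * pi * x) = 2 * pi * of_int h + 2 * pi * d"
    by (simp add: n d_def algebra_simps)
  ultimately have *: "polygon_multiplier N (rcis (K ^ n) (2 * pi * d))"
    by (simp only: rcis_add_2pi_int)
  have "polygon_multiplier N (rcis (K ^ n) t)"
  proof (cases "0 \<le> d")
    case False
    have "cnj (rcis (K ^ n) (2 * pi * d)) = rcis (K ^ n) t"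
      using False by (simp add: t_def rcis_def cis_cnj)
    then show ?thesis
      using polygon_multiplier_cnj[OF *] by simp
  qed (use * in \<open>simp add: t_def\<close>)
  then have arc: "K ^ n * cos (t - \<beta>) \<le> cos \<beta>"
    unfolding \<beta>_def using N K t t_less \<beta> by (intro multiplier_first_arc) auto
  \<comment> \<open>Half of \<open>cos (t - \<beta>) - cos \<beta>\<close>, the gap between chord
    and circle, is this product of sines.\<close>
  have "(\<beta> / 2) / 2 * ((t / 2) / 2) \<le> sin (\<beta> - t / 2) * sin (t / 2)"
  proof (intro mult_mono)
    have "\<beta> / 2 / 2 \<le> (\<beta> - t / 2) / 2"
      using t_less by simp
    also have "\<dots> \<le> sin (\<beta> - t / 2)"
      using t t_less \<beta> by (intro half_le_sin) auto
    finally show "\<beta> / 2 / 2 \<le> sin (\<beta> - t / 2)" .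
    show "0 \<le> sin (\<beta> - t / 2)"
      using t t_less \<beta> by (intro sin_ge_zero) auto
    show "t / 2 / 2 \<le> sin (t / 2)"
      using t t_less \<beta> by (intro half_le_sin) auto
  qed (use t in auto)
  moreover have "cos (t - \<beta>) - cos \<beta> = 2 * (sin (\<beta> - t / 2) * sin (t / 2))"
  proof -
    have "cos (\<beta> - t) - cos \<beta> = 2 * sin ((\<beta> - t + \<beta>) / 2) * sin ((\<beta> - (\<beta> - t)) / 2)"
      by (rule cos_diff_cos)
    also have "(\<beta> - t + \<beta>) / 2 = \<beta> - t / 2"
      by (simp add: field_simps)
    also have "(\<beta> - (\<beta> - t)) / 2 = t / 2"
      by simp
    finally show ?thesis
      using cos_minus[of "\<beta> - t"] by (simp add: mult.assoc)
  qed
  ultimately have cos_ge: "\<beta> * t / 8 \<le> cos (t - \<beta>) - cos \<beta>"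
    by simp
  have "c / (real N)\<^sup>2 \<le> \<beta> * t / 8"
  proof -
    have "8 \<le> pi * pi"
      using mult_mono[of 3 pi 3 pi] pi_gt3 by simp
    then have "c / (real N)\<^sup>2 * 8 \<le> c / (real N)\<^sup>2 * (pi * pi)"
      using c by (intro mult_left_mono) auto
    also have "\<dots> = \<beta> * (c * \<beta>)"
      by (simp add: \<beta>_def power2_eq_square)
    also have "\<dots> \<le> \<beta> * t"
      using t_ge \<beta> by (intro mult_left_mono) auto
    finally show ?thesis by simp
  qed
  also have "\<dots> \<le> cos (t - \<beta>) - K ^ n * cos (t - \<beta>)"
    using arc cos_ge by simp
  also have "\<dots> = (1 - K ^ n) * cos (t - \<beta>)"
    by (simp add: algebra_simps)
  also have "\<dots> \<le> (1 - K ^ n) * 1"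
    using K by (intro mult_left_mono) (auto intro: power_le_one)
  \<comment> \<open>Bernoulli's inequality passes from the power to the multiplier; the factor n is
    at most \<open>2 * N\<close>.\<close>
  also have "\<dots> \<le> real n * (1 - K)"
    using Bernoulli_inequality[of "K - 1" n] K by (simp add: algebra_simps)
  also have "\<dots> \<le> 2 * real N * (1 - K)"
    using n K by (intro mult_right_mono) auto
  finally have "c / (real N)\<^sup>2 / (2 * real N) \<le> 1 - K"
    using N by (subst pos_divide_le_eq) (auto simp: mult.commute)
  then show ?thesis
    by (simp add: K_def power2_eq_square power3_eq_cube mult_ac)
qed

text \<open>A Dirichlet denominator q serves as the number of vertices. Bad approximability forces
  \<open>c * N < q\<close>, while the remaining angle is at most \<open>2 * \<beta> / N\<close> with
  \<open>\<beta> = pi / q\<close>. The loss is then at most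
  \<open>4 * \<beta>\<^sup>2 / N\<close>.\<close>

lemma one_minus_K_radius_le:
  assumes bad: "\<forall>a b :: int. 1 \<le> b \<longrightarrow> c / (of_int b)\<^sup>2 \<le> \<bar>x - of_int a / of_int b\<bar>"
    and c: "0 < c" and N: "0 < N" "3 / c \<le> real N"
  shows "1 - K_radius N (2 * pi * x) \<le> (4 * pi\<^sup>2 / c\<^sup>2) / real N ^ 3"
proof -
  obtain h k where hk: "0 < k" "k \<le> int N" "\<bar>of_int k * x - of_int h\<bar> < 1 / real N"
    using Dirichlet_approx[OF N(1), of x] by metis
  define q where "q = nat k"
  have q: "real q = of_int k" "q \<le> N" "0 < q"
    using hk by (simp_all add: q_def)
  have "c / real q \<le> \<bar>of_int k * x - of_int h\<bar>"
    unfolding q by (rule badly_approximable_dist[OF bad hk(1)])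
  also note hk(3)
  finally have cN: "c * real N < real q"
    using q N by (simp add: field_simps)
  \<comment> \<open>The lower bound on N guarantees an actual polygon,
    \<open>q \<ge> 3\<close>.\<close>
  moreover have "3 \<le> c * real N"
    using N c by (simp add: field_simps)
  ultimately have q3: "3 \<le> q"
    by linarith
  define \<beta> where "\<beta> = pi / real q"
  define \<delta> where "\<delta> = 2 * pi * ((of_int k * x - of_int h) / real q)"
  define d where "d = \<bar>\<delta>\<bar>"
  have \<beta>: "0 < \<beta>" "\<beta> \<le> pi / 3"
    using q3 by (simp_all add: \<beta>_def field_simps)
  have "d = 2 * pi * (\<bar>of_int k * x - of_int h\<bar> / real q)"
    by (simp add: d_def \<delta>_def abs_mult)
  also have "\<dots> \<le> 2 * pi * (1 / real N / real q)"
    using hk(3) by (intro mult_left_mono divide_right_mono) auto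
  finally have d_le: "d \<le> 2 * \<beta> / real N"
    by (simp add: \<beta>_def mult.commute)
  also have "\<dots> \<le> 2 * \<beta>"
    using N \<beta> by (simp add: divide_le_eq)
  finally have d: "0 \<le> d" "d \<le> 2 * \<beta>"
    by (auto simp: d_def)
  have "2 * pi * x = 2 * pi * (of_int h / real q) + \<delta>"
    using q by (simp add: \<delta>_def field_simps)
  then have "cos \<beta> / cos (\<beta> - d) \<le> K_radius N (2 * pi * x)"
    using K_radius_ge_regular[of q N \<delta> "2 * pi * x" h] q3 q d by (simp add: \<beta>_def d_def)
  then have "1 - K_radius N (2 * pi * x) \<le> 1 - cos \<beta> / cos (\<beta> - d)"
    by simp
  also have "\<dots> \<le> 2 * (cos (\<beta> - d) - cos \<beta>)"
  proof -
    have "cos (\<bar>\<beta> - d\<bar>) \<ge> cos \<beta>"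
      using d \<beta> by (intro cos_monotone_0_pi_le) auto
    then have ge: "cos \<beta> \<le> cos (\<beta> - d)"
      by simp
    moreover have half: "1 / 2 \<le> cos \<beta>"
      unfolding \<beta>_def by (rule cos_pi_div_ge_half[OF q3])
    ultimately have "(cos (\<beta> - d) - cos \<beta>) * 1 \<le> (cos (\<beta> - d) - cos \<beta>) * (2 * cos (\<beta> - d))"
      by (intro mult_left_mono) auto
    moreover have "0 < cos (\<beta> - d)"
      using ge half by linarith
    ultimately show ?thesis
      by (simp add: field_simps)
  qed
  also have "\<dots> \<le> 2 * (\<beta> * d)"
  proof -
    have "cos (\<beta> - d) - cos \<beta> = 2 * (sin ((\<beta> - d + \<beta>) / 2) * sin ((\<beta> - (\<beta> - d)) / 2))"
      by (simp only: cos_diff_cos mult.assoc)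
    also have "\<dots> \<le> 2 * (\<beta> * (d / 2))"
    proof (intro mult_left_mono mult_mono)
      show "sin ((\<beta> - d + \<beta>) / 2) \<le> \<beta>"
        using sin_x_le_x[of "(\<beta> - d + \<beta>) / 2"] d \<beta> by simp
      show "sin ((\<beta> - (\<beta> - d)) / 2) \<le> d / 2"
        using sin_x_le_x[of "d / 2"] d by simp
      show "0 \<le> sin ((\<beta> - (\<beta> - d)) / 2)"
        using d \<beta> by (intro sin_ge_zero) auto
    qed (use \<beta> in auto)
    finally show ?thesis by simp
  qed
  also have "\<dots> \<le> 2 * (\<beta> * (2 * \<beta> / real N))"
    using d_le \<beta> by (intro mult_left_mono) auto
  also have "\<dots> = 4 * pi\<^sup>2 / real N * (1 / (real q)\<^sup>2)"
    by (simp add: \<beta>_def power2_eq_square)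
  also have "\<dots> \<le> 4 * pi\<^sup>2 / real N * (1 / (c * real N)\<^sup>2)"
    using cN c N q by (intro mult_left_mono divide_left_mono power_mono mult_pos_pos zero_less_power) auto
  also have "\<dots> = (4 * pi\<^sup>2 / c\<^sup>2) / real N ^ 3"
    by (simp add: power2_eq_square power3_eq_cube)
  finally show ?thesis .
qed

lemma badly_approximable_K_radius:
  assumes "badly_approximable x"
  obtains c C M where "0 < c" "0 < C"
    "\<And>N. 4 \<le> N \<Longrightarrow> c / real N ^ 3 \<le> 1 - K_radius N (2 * pi * x)"
    "\<And>N. 4 \<le> N \<Longrightarrow> M \<le> N \<Longrightarrow> 1 - K_radius N (2 * pi * x) \<le> C / real N ^ 3"
proof -
  obtain c where c: "0 < c" and
    bad: "\<forall>a b :: int. 1 \<le> b \<longrightarrow> c / (of_int b)\<^sup>2 \<le> \<bar>x - of_int a / of_int b\<bar>"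
    using assms unfolding badly_approximable_def by blast
  show ?thesis
  proof (rule that)
    show "0 < c / 2" "0 < 4 * pi\<^sup>2 / c\<^sup>2"
      using c by simp_all
    show "c / 2 / real N ^ 3 \<le> 1 - K_radius N (2 * pi * x)" if "4 \<le> N" for N
      using one_minus_K_radius_ge[OF bad c] that by simp
    show "1 - K_radius N (2 * pi * x) \<le> 4 * pi\<^sup>2 / c\<^sup>2 / real N ^ 3"
      if "4 \<le> N" "nat \<lceil>3 / c\<rceil> \<le> N" for N
      using one_minus_K_radius_le[OF bad c, of N] that by linarith
  qed
qed

section \<open>From radii to expansion factors and vertex counts\<close>

lemma inverse_minus_1_bounds:
  assumes "1 / 2 \<le> (K::real)" "K \<le> 1"
  shows "1 - K \<le> 1 / K - 1" and "1 / K - 1 \<le> 2 * (1 - K)"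
proof -
  have eq: "1 / K - 1 = (1 - K) / K"
    using assms by (simp add: diff_divide_distrib)
  have "(1 - K) * K \<le> (1 - K) * 1"
    using assms by (intro mult_left_mono) auto
  then show "1 - K \<le> 1 / K - 1"
    unfolding eq using assms by (subst pos_le_divide_eq) auto
  have "(1 - K) * 1 \<le> (1 - K) * (2 * K)"
    using assms by (intro mult_left_mono) auto
  then show "1 / K - 1 \<le> 2 * (1 - K)"
    unfolding eq using assms by (subst pos_divide_le_eq) (auto simp: mult_ac)
qed

lemma badly_approximable_inverse_K_radius:
  assumes "badly_approximable x"
  obtains c C M where "0 < c" "0 < C"
    "\<And>N. 4 \<le> N \<Longrightarrow> c / real N ^ 3 \<le> 1 / K_radius N (2 * pi * x) - 1"
    "\<And>N. 4 \<le> N \<Longrightarrow> M \<le> N \<Longrightarrow> 1 / K_radius N (2 * pi * x) - 1 \<le> C / real N ^ 3"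
proof -
  obtain c C M where *: "0 < c" "0 < C"
    "\<And>N. 4 \<le> N \<Longrightarrow> c / real N ^ 3 \<le> 1 - K_radius N (2 * pi * x)"
    "\<And>N. 4 \<le> N \<Longrightarrow> M \<le> N \<Longrightarrow> 1 - K_radius N (2 * pi * x) \<le> C / real N ^ 3"
    using badly_approximable_K_radius[OF assms] by blast
  have K: "1 / 2 \<le> K_radius N (2 * pi * x)" "K_radius N (2 * pi * x) \<le> 1" if "4 \<le> N" for N
    using K_radius_ge_cos[of N "2 * pi * x"] cos_pi_div_ge_half[of N] K_radius_le_1[of N] that by auto
  show ?thesis
  proof (rule that)
    show "0 < c" "0 < 2 * C"
      using * by simp_all
    show "c / real N ^ 3 \<le> 1 / K_radius N (2 * pi * x) - 1" if "4 \<le> N" for N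
      using *(3)[OF that] inverse_minus_1_bounds(1)[OF K[OF that]] by linarith
    show "1 / K_radius N (2 * pi * x) - 1 \<le> 2 * C / real N ^ 3" if "4 \<le> N" "M \<le> N" for N
    proof -
      have "2 * (1 - K_radius N (2 * pi * x)) \<le> 2 * (C / real N ^ 3)"
        using *(4)[OF that] by simp
      then show ?thesis
        using inverse_minus_1_bounds(2)[OF K[OF that(1)]] by simp
    qed
  qed
qed

lemma comparable_inverse_cubeI:
  assumes "0 < c" "0 < C" "\<And>N. 4 \<le> N \<Longrightarrow> c / real N ^ 3 \<le> f N"
    and "\<And>N. 4 \<le> N \<Longrightarrow> M \<le> N \<Longrightarrow> f N \<le> C / real N ^ 3"
  shows "comparable c C sequentially f (\<lambda>N. 1 / real N ^ 3)"
proof -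
  have "c \<le> f N / (1 / real N ^ 3) \<and> f N / (1 / real N ^ 3) \<le> C" if "max 4 M \<le> N" for N
    using assms(3)[of N] assms(4)[of N] that
    by (auto simp: pos_divide_le_eq pos_le_divide_eq mult.commute)
  then show ?thesis
    unfolding comparable_def using assms(1,2)
    by (intro conjI eventually_sequentiallyI[of "max 4 M"]) blast+
qed

text \<open>The cubic law is inverted at two points only: the rounded cube root of
  \<open>C / \<epsilon>\<close> is admissible, hence an upper bound for the least N, and the least N
  is itself admissible, which bounds it below through c.\<close>

lemma Least_vertex_bound_comparable:
  fixes f :: "nat \<Rightarrow> real"
  assumes "0 < c" "0 < C" "\<And>N. 4 \<le> N \<Longrightarrow> c / real N ^ 3 \<le> f N"
    and "\<And>N. 4 \<le> N \<Longrightarrow> M \<le> N \<Longrightarrow> f N \<le> C / real N ^ 3"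
  shows "comparable (c powr (1 / 3)) (2 * C powr (1 / 3)) (at_right 0)
    (\<lambda>\<epsilon>. real (LEAST N. 4 \<le> N \<and> f N \<le> \<epsilon>)) (\<lambda>\<epsilon>. \<epsilon> powr (- 1 / 3))"
proof -
  define m where "m = real (max 4 M)"
  have m: "0 < m"
    by (simp add: m_def)
  have bounds: "c powr (1 / 3) \<le> real (LEAST N. 4 \<le> N \<and> f N \<le> \<epsilon>) / \<epsilon> powr (- 1 / 3) \<and>
      real (LEAST N. 4 \<le> N \<and> f N \<le> \<epsilon>) / \<epsilon> powr (- 1 / 3) \<le> 2 * C powr (1 / 3)"
    if \<epsilon>: "0 < \<epsilon>" "\<epsilon> < C / m ^ 3" for \<epsilon>
  proof -
    define s where "s = (C / \<epsilon>) powr (1 / 3)"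
    define L where "L = nat \<lceil>s\<rceil>"
    define B where "B = (LEAST N. 4 \<le> N \<and> f N \<le> \<epsilon>)"
    have s_eq: "s = C powr (1 / 3) * \<epsilon> powr (- 1 / 3)"
      using assms(2) \<epsilon> by (simp add: s_def powr_divide powr_minus_divide)
    have s3: "s ^ 3 = C / \<epsilon>"
      using assms(2) \<epsilon> by (simp add: s_def powr_powr flip: powr_numeral)
    have "m ^ 3 < s ^ 3"
      unfolding s3 using \<epsilon> m by (simp add: field_simps)
    \<comment> \<open>A small \<epsilon> places s beyond \<open>max 4 M\<close>. Hence the estimate
      by C is available at L, and \<open>s + 1 \<le> 2 * s\<close> absorbs the rounding.\<close>
    then have "m < s"
      by (rule power_less_imp_less_base) (simp add: s_def)
    then have L: "s \<le> real L" "real L \<le> s + 1" "max 4 M \<le> L"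
      unfolding L_def m_def by linarith+
    have "f L \<le> C / real L ^ 3"
      using assms(4)[of L] L by simp
    also have "\<dots> \<le> C / s ^ 3"
      using assms(2) L \<open>m < s\<close> m by (intro divide_left_mono power_mono mult_pos_pos zero_less_power) auto
    also have "\<dots> = \<epsilon>"
      unfolding s3 using assms(2) \<epsilon> by simp
    finally have PL: "4 \<le> L \<and> f L \<le> \<epsilon>"
      using L by simp
    have B: "4 \<le> B" "f B \<le> \<epsilon>"
      unfolding B_def using LeastI[of "\<lambda>N. 4 \<le> N \<and> f N \<le> \<epsilon>", OF PL] by auto
    have "B \<le> L"
      unfolding B_def by (rule Least_le[of "\<lambda>N. 4 \<le> N \<and> f N \<le> \<epsilon>", OF PL])
    then have "real B \<le> 2 * s"
      using L \<open>m < s\<close> by (simp add: m_def)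
    then have "real B \<le> 2 * C powr (1 / 3) * \<epsilon> powr (- 1 / 3)"
      by (simp add: s_eq)
    moreover have "c powr (1 / 3) * \<epsilon> powr (- 1 / 3) \<le> real B"
    proof -
      have "c / real B ^ 3 \<le> \<epsilon>"
        using assms(3)[OF B(1)] B(2) by linarith
      then have "c / \<epsilon> \<le> real B ^ 3"
        using B(1) \<epsilon> by (simp add: field_simps)
      then have "(c / \<epsilon>) powr (1 / 3) \<le> (real B ^ 3) powr (1 / 3)"
        using assms(1) \<epsilon> by (intro powr_mono2) auto
      also have "\<dots> = real B"
        using B(1) by (simp add: powr_powr flip: powr_numeral)
      also have "(c / \<epsilon>) powr (1 / 3) = c powr (1 / 3) * \<epsilon> powr (- 1 / 3)"
        using assms(1) \<epsilon> by (simp add: powr_divide powr_minus_divide)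
      finally show ?thesis .
    qed
    ultimately show ?thesis
      using \<epsilon> by (simp add: B_def pos_le_divide_eq pos_divide_le_eq)
  qed
  have "0 < C / m ^ 3"
    using assms(2) m by simp
  then have "\<forall>\<^sub>F \<epsilon> in at_right 0. 0 < \<epsilon> \<and> \<epsilon> < C / m ^ 3"
    by (auto simp: eventually_at_right_field)
  then show ?thesis
    unfolding comparable_def using assms(1,2) bounds by (auto elim: eventually_mono)
qed

section \<open>Uniform bounds\<close>

lemma inverse_cos_pi_div_asymp_equiv:
  "(\<lambda>N. 1 / cos (pi / real N) - 1) \<sim>[sequentially] (\<lambda>N. pi\<^sup>2 / (2 * (real N)\<^sup>2))"
proof -
  have "(\<lambda>u::real. 1 / cos u - 1) \<sim>[at_right 0] (\<lambda>u. u\<^sup>2 / 2)"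
    by real_asymp
  moreover have "filterlim (\<lambda>N. pi / real N) (at_right 0) sequentially"
    by real_asymp
  ultimately have "(\<lambda>N. 1 / cos (pi / real N) - 1) \<sim>[sequentially] (\<lambda>N. (pi / real N)\<^sup>2 / 2)"
    by (rule asymp_equiv_compose')
  then show ?thesis
    by (simp add: power_divide mult.commute)
qed

lemma Gamma_polygon_excess:
  assumes "4 \<le> N" "\<theta> \<in> {0..pi}" "0 < \<rho>"
  shows "Gamma_polygon N (scaled_rotation \<rho> \<theta>) / \<rho> - 1 = 1 / K_radius N \<theta> - 1"
  using Gamma_polygon_scaled_rotation[OF assms] assms(3) by simp

lemma Gamma_polygon_excess_le:
  assumes "4 \<le> N" "\<theta> \<in> {0..pi}" "0 < \<rho>"
  shows "Gamma_polygon N (scaled_rotation \<rho> \<theta>) / \<rho> - 1 \<le> 1 / cos (pi / real N) - 1"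
proof -
  have "0 < cos (pi / real N)"
    using cos_pi_div_ge_half[of N] assms(1) by simp
  moreover have "cos (pi / real N) \<le> K_radius N \<theta>"
    using assms(1) by (intro K_radius_ge_cos) simp
  ultimately have "1 / K_radius N \<theta> \<le> 1 / cos (pi / real N)"
    by (intro divide_left_mono) auto
  then show ?thesis
    unfolding Gamma_polygon_excess[OF assms] by simp
qed

lemma Gamma_polygon_excess_pi_div:
  assumes "4 \<le> N" "0 < \<rho>"
  shows "Gamma_polygon N (scaled_rotation \<rho> (pi / real N)) / \<rho> - 1 = 1 / cos (pi / real N) - 1"
proof -
  have "pi / real N \<in> {0..pi}"
    using assms(1) by (simp add: field_simps)
  then show ?thesis
    using assms K_radius_pi_div[of N] by (subst Gamma_polygon_excess) auto
qed

text \<open>The worst angle for N vertices is \<open>pi / N\<close>, so the condition on all angles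
  reduces to \<open>1 / cos (pi / N) \<le> 1 + \<epsilon>\<close>, which is solved for N since cos
  decreases on \<open>{0..pi}\<close>.\<close>

lemma B_unif_eq:
  assumes \<rho>: "0 < \<rho>" and \<epsilon>: "0 < \<epsilon>"
  shows "int (B_unif \<rho> \<epsilon>) = max 4 \<lceil>pi / arccos (inverse (1 + \<epsilon>))\<rceil>"
proof -
  define a where "a = arccos (inverse (1 + \<epsilon>))"
  have inv: "0 < inverse (1 + \<epsilon>)" "inverse (1 + \<epsilon>) < 1"
    using \<epsilon> by (simp_all add: inverse_less_1_iff)
  then have m: "- 1 \<le> inverse (1 + \<epsilon>)" "inverse (1 + \<epsilon>) \<le> 1"
    by linarith+
  have a: "0 < a" "a \<le> pi" "cos a = inverse (1 + \<epsilon>)"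
    unfolding a_def
    using arccos_less_arccos[OF m(1) inv(2) order_refl] arccos_ubound[OF m] cos_arccos[OF m]
    by (simp_all only: arccos_1)
  have iff: "(\<forall>\<theta>\<in>{0..pi}. Gamma_polygon N (scaled_rotation \<rho> \<theta>) / \<rho> - 1 \<le> \<epsilon>) \<longleftrightarrow> \<lceil>pi / a\<rceil> \<le> int N"
    if N: "4 \<le> N" for N
  proof -
    have cN: "0 < cos (pi / real N)"
      using cos_pi_div_ge_half[of N] N by simp
    have piN: "pi / real N \<in> {0..pi}"
      using N by (simp add: field_simps)
    have "(\<forall>\<theta>\<in>{0..pi}. Gamma_polygon N (scaled_rotation \<rho> \<theta>) / \<rho> - 1 \<le> \<epsilon>) \<longleftrightarrow>
        1 / cos (pi / real N) - 1 \<le> \<epsilon>"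
    proof
      assume "\<forall>\<theta>\<in>{0..pi}. Gamma_polygon N (scaled_rotation \<rho> \<theta>) / \<rho> - 1 \<le> \<epsilon>"
      from bspec[OF this piN] show "1 / cos (pi / real N) - 1 \<le> \<epsilon>"
        unfolding Gamma_polygon_excess_pi_div[OF N \<rho>] .
    next
      assume "1 / cos (pi / real N) - 1 \<le> \<epsilon>"
      then show "\<forall>\<theta>\<in>{0..pi}. Gamma_polygon N (scaled_rotation \<rho> \<theta>) / \<rho> - 1 \<le> \<epsilon>"
        using Gamma_polygon_excess_le[OF N _ \<rho>] order_trans by blast
    qed
    also have "\<dots> \<longleftrightarrow> cos a \<le> cos (pi / real N)"
      using cN \<epsilon> unfolding a(3) by (simp add: field_simps)
    also have "\<dots> \<longleftrightarrow> pi / real N \<le> a"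
      using a piN by (intro cos_mono_le_eq) auto
    also have "\<dots> \<longleftrightarrow> pi / a \<le> real N"
      using a N by (simp add: field_simps)
    also have "\<dots> \<longleftrightarrow> \<lceil>pi / a\<rceil> \<le> int N"
      by (simp add: ceiling_le_iff)
    finally show ?thesis .
  qed
  have "B_unif \<rho> \<epsilon> = (LEAST N. 4 \<le> N \<and> \<lceil>pi / a\<rceil> \<le> int N)"
    unfolding B_unif_def by (intro arg_cong[of _ _ Least] ext conj_cong refl iff)
  also have "\<dots> = nat (max 4 \<lceil>pi / a\<rceil>)"
    by (rule Least_equality) auto
  finally show ?thesis
    by (simp add: a_def)
qed

text \<open>As \<epsilon> tends to 0, arccos is evaluated near its singular endpoint 1. Passing to
  the tangent of the angle moves the expansion to arctan at 0 and isolates the square root.\<close>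

lemma arccos_inverse_eq_arctan:
  assumes "0 < (\<epsilon>::real)"
  shows "arccos (inverse (1 + \<epsilon>)) = arctan (sqrt ((1 + \<epsilon>)\<^sup>2 - 1))"
proof (rule arccos_unique)
  show "cos (arctan (sqrt ((1 + \<epsilon>)\<^sup>2 - 1))) = inverse (1 + \<epsilon>)"
    using assms by (simp add: cos_arctan inverse_eq_divide)
  show "0 \<le> arctan (sqrt ((1 + \<epsilon>)\<^sup>2 - 1))"
    using assms by simp
  show "arctan (sqrt ((1 + \<epsilon>)\<^sup>2 - 1)) \<le> pi"
    using arctan_ubound[of "sqrt ((1 + \<epsilon>)\<^sup>2 - 1)"] pi_gt_zero by linarith
qed

text \<open>The quotient g tends to infinity, so the maximum with 4 is eventually irrelevant, and
  the ceiling, lying between g and g + 1, has the same asymptotics.\<close>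

lemma B_unif_asymp_equiv:
  assumes \<rho>: "0 < \<rho>"
  shows "(\<lambda>\<epsilon>. real (B_unif \<rho> \<epsilon>)) \<sim>[at_right 0] (\<lambda>\<epsilon>. pi / sqrt (2 * \<epsilon>))"
proof (rule asymp_equiv_sandwich_real)
  let ?g = "\<lambda>\<epsilon>::real. pi / arctan (sqrt ((1 + \<epsilon>)\<^sup>2 - 1))"
  show "?g \<sim>[at_right 0] (\<lambda>\<epsilon>. pi / sqrt (2 * \<epsilon>))"
    by real_asymp
  show "(\<lambda>\<epsilon>. ?g \<epsilon> + 1) \<sim>[at_right 0] (\<lambda>\<epsilon>. pi / sqrt (2 * \<epsilon>))"
    by real_asymp
  have ev: "\<forall>\<^sub>F \<epsilon> in at_right (0::real). 4 \<le> ?g \<epsilon> \<and> 0 < \<epsilon>"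
    by (intro eventually_conj) real_asymp+
  have B: "real (B_unif \<rho> \<epsilon>) = of_int \<lceil>?g \<epsilon>\<rceil>" if "4 \<le> ?g \<epsilon> \<and> 0 < \<epsilon>" for \<epsilon>
  proof -
    have "(4::int) \<le> \<lceil>?g \<epsilon>\<rceil>"
      using that by linarith
    then have "int (B_unif \<rho> \<epsilon>) = \<lceil>?g \<epsilon>\<rceil>"
      using B_unif_eq[OF \<rho>, of \<epsilon>] that arccos_inverse_eq_arctan[of \<epsilon>] by simp
    then show ?thesis
      by (metis of_int_of_nat_eq)
  qed
  show "\<forall>\<^sub>F \<epsilon> in at_right 0. real (B_unif \<rho> \<epsilon>) \<in> {?g \<epsilon>..?g \<epsilon> + 1}"
    using ev
  proof eventually_elim
    case (elim \<epsilon>)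
    show ?case
      unfolding B[OF elim] atLeastAtMost_iff by linarith
  qed
qed

lemma B_angle_eq:
  assumes "0 \<le> x" "x \<le> 1 / 2" "0 < \<rho>"
  shows "B_angle \<rho> x \<epsilon> = (LEAST N. 4 \<le> N \<and> 1 / K_radius N (2 * pi * x) - 1 \<le> \<epsilon>)"
proof -
  have "2 * pi * x \<in> {0..pi}"
    using assms by simp
  then show ?thesis
    unfolding B_angle_def using Gamma_polygon_excess[OF _ _ assms(3)]
    by (intro arg_cong[of _ _ Least]) auto
qed

text \<open>The maximum over the angles is stated as a bound together with an angle attaining it.
  The comparison constants are quantified before \<rho> and the asymptotic variable, so they depend
  on x alone.\<close>

theorem corollary8p2:
  fixes x :: real
  assumes "0 \<le> x" and "x \<le> 1 / 2"
  shows
    "(\<forall>N\<ge>4. \<forall>a b :: int. 1 \<le> b \<longrightarrow> coprime a b \<longrightarrow> x = of_int a / of_int b \<longrightarrow>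
        (K_radius N (2 * pi * x) = 1 \<longleftrightarrow> b \<le> int N)) \<and>
     (x \<notin> \<rat> \<longrightarrow> (\<forall>N\<ge>4. K_radius N (2 * pi * x) < 1)) \<and>
     (badly_approximable x \<longrightarrow>
        (\<exists>c C. comparable c C sequentially
           (\<lambda>N. 1 - K_radius N (2 * pi * x)) (\<lambda>N. 1 / real N ^ 3)) \<and>
        (\<exists>c C. \<forall>\<rho>>0. comparable c C sequentially
           (\<lambda>N. Gamma_polygon N (scaled_rotation \<rho> (2 * pi * x)) / \<rho> - 1) (\<lambda>N. 1 / real N ^ 3))) \<and>
     (\<forall>\<rho>>0. \<forall>N\<ge>4.
        (\<forall>\<theta>\<in>{0..pi}. Gamma_polygon N (scaled_rotation \<rho> \<theta>) / \<rho> - 1 \<le> 1 / cos (pi / real N) - 1) \<and>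
        (\<exists>\<theta>\<in>{0..pi}. Gamma_polygon N (scaled_rotation \<rho> \<theta>) / \<rho> - 1 = 1 / cos (pi / real N) - 1)) \<and>
     (\<lambda>N. 1 / cos (pi / real N) - 1) \<sim>[sequentially] (\<lambda>N. pi\<^sup>2 / (2 * (real N)\<^sup>2)) \<and>
     (badly_approximable x \<longrightarrow>
        (\<exists>c C. \<forall>\<rho>>0. comparable c C (at_right 0)
           (\<lambda>\<epsilon>. real (B_angle \<rho> x \<epsilon>)) (\<lambda>\<epsilon>. \<epsilon> powr (- 1 / 3)))) \<and>
     (\<forall>\<rho>>0. \<forall>\<epsilon>>0.
        int (B_unif \<rho> \<epsilon>) = max 4 \<lceil>pi / arccos (inverse (1 + \<epsilon>))\<rceil>) \<and>
     (\<forall>\<rho>>0. (\<lambda>\<epsilon>. real (B_unif \<rho> \<epsilon>)) \<sim>[at_right 0] (\<lambda>\<epsilon>. pi / sqrt (2 * \<epsilon>))) \<and>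
     (\<forall>\<rho>>0. \<forall>\<rho>'>0. \<forall>\<epsilon>>0. B_angle \<rho> x \<epsilon> = B_angle \<rho>' x \<epsilon> \<and> B_unif \<rho> \<epsilon> = B_unif \<rho>' \<epsilon>)"
proof (intro conjI allI impI ballI)
  have ang: "2 * pi * x \<in> {0..pi}"
    using assms by simp
  show "K_radius N (2 * pi * x) = 1 \<longleftrightarrow> b \<le> int N"
    if "4 \<le> N" "1 \<le> b" "coprime a b" "x = of_int a / of_int b" for N and a b :: int
    using K_radius_eq_1_iff[of N "2 * pi * x"] unimodular_multiplier_rational[of N x a b]
      rational_rotation_multiplier[of b N a] that by auto
  show "K_radius N (2 * pi * x) < 1" if "x \<notin> \<rat>" "4 \<le> N" for N
    using K_radius_eq_1_iff[of N "2 * pi * x"] K_radius_le_1[of N "2 * pi * x"]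
      unimodular_multiplier_imp_rational[of N x] that by auto
  show "\<exists>c C. comparable c C sequentially (\<lambda>N. 1 - K_radius N (2 * pi * x)) (\<lambda>N. 1 / real N ^ 3)"
    if bad: "badly_approximable x"
    using badly_approximable_K_radius[OF bad] comparable_inverse_cubeI by metis
  show "\<exists>c C. \<forall>\<rho>>0. comparable c C sequentially
      (\<lambda>N. Gamma_polygon N (scaled_rotation \<rho> (2 * pi * x)) / \<rho> - 1) (\<lambda>N. 1 / real N ^ 3)"
    if bad: "badly_approximable x"
  proof -
    \<comment> \<open>The constants come from \<open>K_radius\<close>, in which \<rho> does not
      occur, and so are fixed before \<rho> is chosen.\<close>
    obtain c C M where *: "0 < c" "0 < C"
      "\<And>N. 4 \<le> N \<Longrightarrow> c / real N ^ 3 \<le> 1 / K_radius N (2 * pi * x) - 1"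
      "\<And>N. 4 \<le> N \<Longrightarrow> M \<le> N \<Longrightarrow> 1 / K_radius N (2 * pi * x) - 1 \<le> C / real N ^ 3"
      using badly_approximable_inverse_K_radius[OF bad] by blast
    have "comparable c C sequentially
      (\<lambda>N. Gamma_polygon N (scaled_rotation \<rho> (2 * pi * x)) / \<rho> - 1) (\<lambda>N. 1 / real N ^ 3)"
      if "0 < \<rho>" for \<rho>
      using *(3,4) Gamma_polygon_excess[OF _ ang that]
      by (intro comparable_inverse_cubeI[OF *(1,2), where M = M]) auto
    then show ?thesis
      by blast
  qed
  show "\<exists>c C. \<forall>\<rho>>0. comparable c C (at_right 0)
      (\<lambda>\<epsilon>. real (B_angle \<rho> x \<epsilon>)) (\<lambda>\<epsilon>. \<epsilon> powr (- 1 / 3))"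
    if bad: "badly_approximable x"
  proof -
    obtain c C M where *: "0 < c" "0 < C"
      "\<And>N. 4 \<le> N \<Longrightarrow> c / real N ^ 3 \<le> 1 / K_radius N (2 * pi * x) - 1"
      "\<And>N. 4 \<le> N \<Longrightarrow> M \<le> N \<Longrightarrow> 1 / K_radius N (2 * pi * x) - 1 \<le> C / real N ^ 3"
      using badly_approximable_inverse_K_radius[OF bad] by blast
    show ?thesis
      using Least_vertex_bound_comparable[OF *] B_angle_eq[OF assms] by auto
  qed
  show "Gamma_polygon N (scaled_rotation \<rho> \<theta>) / \<rho> - 1 \<le> 1 / cos (pi / real N) - 1"
    if "0 < \<rho>" "4 \<le> N" "\<theta> \<in> {0..pi}" for \<rho> N \<theta>
    using Gamma_polygon_excess_le that by blast
  show "\<exists>\<theta>\<in>{0..pi}. Gamma_polygon N (scaled_rotation \<rho> \<theta>) / \<rho> - 1 = 1 / cos (pi / real N) - 1"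
    if "0 < \<rho>" "4 \<le> N" for \<rho> N
    using Gamma_polygon_excess_pi_div[OF that(2,1)] that
    by (intro bexI[of _ "pi / real N"]) (auto simp: field_simps)
  show "(\<lambda>N. 1 / cos (pi / real N) - 1) \<sim>[sequentially] (\<lambda>N. pi\<^sup>2 / (2 * (real N)\<^sup>2))"
    by (rule inverse_cos_pi_div_asymp_equiv)
  show "int (B_unif \<rho> \<epsilon>) = max 4 \<lceil>pi / arccos (inverse (1 + \<epsilon>))\<rceil>" if "0 < \<rho>" "0 < \<epsilon>" for \<rho> \<epsilon>
    using B_unif_eq that by blast
  show "(\<lambda>\<epsilon>. real (B_unif \<rho> \<epsilon>)) \<sim>[at_right 0] (\<lambda>\<epsilon>. pi / sqrt (2 * \<epsilon>))" if "0 < \<rho>" for \<rho>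
    using B_unif_asymp_equiv that by blast
  show "B_angle \<rho> x \<epsilon> = B_angle \<rho>' x \<epsilon>" if "0 < \<rho>" "0 < \<rho>'" for \<rho> \<rho>' \<epsilon>
    using B_angle_eq[OF assms] that by simp
  show "B_unif \<rho> \<epsilon> = B_unif \<rho>' \<epsilon>" if "0 < \<rho>" "0 < \<rho>'" "0 < \<epsilon>" for \<rho> \<rho>' \<epsilon>
    using B_unif_eq[of \<rho> \<epsilon>] B_unif_eq[of \<rho>' \<epsilon>] that by linarith
qed

end
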